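(* There exist absolute constants $C, c_1>0$ such that the following holds. Let $d, N \in \mathbb{N}$ be arbitrary and let $\Phi:\mathbb{R}^d\to\mathbb{R}$, $\Phi(x) = W^{(1)}\,\mathrm{ReLU}(W^{(0)}x + b^{(0)}) + b^{(1)}$, be a random shallow ReLU network of width $N$, where $W^{(0)}\in\mathbb{R}^{N\times d}$ has i.i.d. $\mathcal{N}(0,2/N)$ entries, $W^{(1)}\in\mathbb{R}^{1\times N}$ has i.i.d. $\mathcal{N}(0,1)$ entries, $b^{(0)}_i \sim \mathcal{D}^{(0)}_i$ ($1\le i\le N$) and $b^{(1)}\sim\mathcal{D}^{(1)}_1$ for arbitrary probability distributions $\mathcal{D}^{(0)}_i,\mathcal{D}^{(1)}_1$ on $\mathbb{R}$, and $W^{(0)},W^{(1)},b^{(0)},b^{(1)}$ are jointly independent. Then: (1) $\mathrm{Lip}(\Phi)\le C\sqrt{d}$ with probability at least $(1-2\exp(-\min\{d,N\}))\cdot(1-2\exp(-c_1\max\{d,N\}))_+$; (2) $\mathbb{E}[\mathrm{Lip}(\Phi)]\le C\sqrt{d}$.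
   Context: $\mathrm{ReLU}(t)=\max\{0,t\}$ is applied componentwise. For $f:\mathbb{R}^d\to\mathbb{R}$, $\mathrm{Lip}(f)=\sup_{x\neq y}|f(x)-f(y)|/\|x-y\|_2$. For $a\in\mathbb{R}$, $a_+=\max\{0,a\}$. *)

theory Defs
  imports "HOL-Probability.Probability"
begin

definition Rd :: "nat \<Rightarrow> (nat \<Rightarrow> real) set" where
  "Rd d = {x. \<forall>j\<ge>d. x j = 0}"

definition dist_Rd :: "nat \<Rightarrow> (nat \<Rightarrow> real) \<Rightarrow> (nat \<Rightarrow> real) \<Rightarrow> real" where
  "dist_Rd d x y = sqrt (\<Sum>j<d. (x j - y j)\<^sup>2)"

definition Lip :: "nat \<Rightarrow> ((nat \<Rightarrow> real) \<Rightarrow> real) \<Rightarrow> ennreal" where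
  "Lip d f = (SUP p \<in> {(x, y). x \<in> Rd d \<and> y \<in> Rd d \<and> x \<noteq> y}.
                 ennreal (\<bar>f (fst p) - f (snd p)\<bar> / dist_Rd d (fst p) (snd p)))"

definition relu :: "real \<Rightarrow> real" where
  "relu t = max 0 t"

(* Parameters: (W0, (W1, (b0, b1))) with W0 (i,j) the (i,j) entry of the N x d matrix,
   W1 i the i-th entry of the 1 x N matrix, b0 i the i-th bias entry, b1 the output bias.
   Indices are 0-based: i < N, j < d. *)
type_synonym params = "(nat \<times> nat \<Rightarrow> real) \<times> (nat \<Rightarrow> real) \<times> (nat \<Rightarrow> real) \<times> real"

definition shallow_net :: "nat \<Rightarrow> nat \<Rightarrow> params \<Rightarrow> (nat \<Rightarrow> real) \<Rightarrow> real" where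
  "shallow_net d N \<theta> x =
     (case \<theta> of (W0, W1, b0, b1) \<Rightarrow>
        (\<Sum>i<N. W1 i * relu ((\<Sum>j<d. W0 (i, j) * x j) + b0 i)) + b1)"

(* Law of the parameters: W0 i.i.d. N(0, 2/N) (standard deviation sqrt(2/N)),
   W1 i.i.d. N(0,1), b0 with arbitrary law B0 on R^N, b1 with arbitrary law D1 on R,
   all four jointly independent (product measure). *)
definition param_law :: "nat \<Rightarrow> nat \<Rightarrow> (nat \<Rightarrow> real) measure \<Rightarrow> real measure \<Rightarrow> params measure" where
  "param_law d N B0 D1 =
     (PiM ({..<N} \<times> {..<d}) (\<lambda>_. density lborel (normal_density 0 (sqrt (2 / real N)))))
     \<Otimes>\<^sub>M ((PiM {..<N} (\<lambda>_. density lborel std_normal_density)) \<Otimes>\<^sub>M (B0 \<Otimes>\<^sub>M D1))"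

end

theory Submission
  imports Defs
begin

text \<open>
  Along a segment the network is the integral of its formal gradient
  \<open>\<Sum>\<^sub>i W1\<^sub>i 1[i active at x] w\<^sub>i\<close>, so the Lipschitz constant is at most the supremum over \<open>x\<close> of the
  norm of this vector, and that norm is computed up to a factor 2 on a finite set of directions of
  cardinality at most \<open>exp (4 d)\<close>.

  If \<open>N < d\<close>, Cauchy--Schwarz and chi-square tails suffice. If \<open>d \<le> N\<close>, condition on
  the first layer and the biases and chain over the activation patterns: they have VC dimension at
  most \<open>d + 1\<close>, hence at most \<open>(8 \<cdot> 64\<^sup>k)\<close> to the power \<open>4 d\<close> of them are needed to approximate all
  patterns up to \<open>N / 64\<^sup>k\<close> errors. A link of level \<open>k\<close> is a centred Gaussian in the second layer with
  variance at most of order \<open>N / 8\<^sup>k\<close> (in units of the first layer variance), since few rows cannot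
  carry much mass in any direction, and the union bounds at all levels sum geometrically. The
  chaining stops at \<open>64\<^sup>K \<approx> N / d\<close>, where one passes to all patterns; this is what avoids a
  logarithmic loss.

  All tails are at scale \<open>u\<close> and of size \<open>2 exp (- u min d N)\<close>, so \<open>u = 1\<close> gives the probability
  bound and summation over integer \<open>u\<close> gives the expectation.
\<close>

subsection \<open>Shattering and packing\<close>

text \<open>The activation pattern is chosen after all weights are drawn, and a single union bound
  over all patterns has entropy \<open>d ln (N / d)\<close>, too much by the logarithm. The rates of
  the chain come from three balances. A link of level \<open>k\<close> changes at most
  \<open>2 N / 64^k\<close> rows; cutting squared row values at \<open>24 k\<close> bounds their
  mass by \<open>48 k N / 64^k\<close> plus an excess of order \<open>N / 8^k\<close>, uniformly
  over all sets of rows. The excess has tails with exponent of order \<open>N / 8^k\<close>, which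
  must beat the entropy \<open>4 d\<close> of the directions; as \<open>64 = 8 * 8\<close>, the
  condition \<open>d * 64^k <= N\<close> says precisely \<open>d * 8^k <= N / 8^k\<close>.
  Thresholds \<open>sqrt (d N) / 2^k\<close> against variances \<open>N / 8^k\<close> then give
  Gaussian exponents of order \<open>d 2^k\<close>, above the entropy of order
  \<open>d (k + 1)\<close> of the links, and the thresholds still sum to order
  \<open>sqrt (d N)\<close>; the entry deviation \<open>sqrt (2 / N)\<close> turns this into
  \<open>sqrt d\<close>. Arbitrary biases are harmless: they enter only through the patterns, whose
  VC bound is uniform in them, and the first-layer event speaks of the weights alone.\<close>

definition shatters :: "'a set set \<Rightarrow> 'a set \<Rightarrow> bool" where
  "shatters F B \<longleftrightarrow> (\<forall>A\<subseteq>B. \<exists>S\<in>F. S \<inter> B = A)"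

text \<open>Pajor's form of the Sauer-Shelah lemma, which lends itself to induction. Removing a
  point \<open>a\<close> splits \<open>F\<close> into its traces \<open>F0\<close> and the sets
  \<open>F1\<close> that occur both with and without \<open>a\<close>, and the cardinalities add up.
  A set shattered by \<open>F0\<close> is shattered by \<open>F\<close>; a set shattered by
  \<open>F1\<close> stays shattered by \<open>F\<close> after \<open>a\<close> is inserted. The two
  kinds are told apart by \<open>a\<close>, so their numbers add up as well.\<close>

lemma card_le_shattered:
  assumes "finite X" "F \<subseteq> Pow X"
  shows "card F \<le> card {B. B \<subseteq> X \<and> shatters F B}"
  using assms
proof (induction X arbitrary: F rule: finite_induct)
  case empty
  show ?case
  proof (cases "F = {}")
    case False
    then have F: "F = {{}}" using empty by auto
    have "{B. B \<subseteq> {} \<and> shatters F B} = {{}}" unfolding F shatters_def by auto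
    then show ?thesis using F by simp
  qed simp
next
  case (insert a X)
  define F0 where "F0 = (\<lambda>S. S - {a}) ` F"
  define F1 where "F1 = {S. S \<subseteq> X \<and> S \<in> F \<and> insert a S \<in> F}"
  have finF: "finite F" using insert by (meson finite_Pow_iff finite_insert finite_subset)
  have F0: "F0 \<subseteq> Pow X" using insert.prems unfolding F0_def by auto
  have F1: "F1 \<subseteq> Pow X" unfolding F1_def by auto
  define P where "P = {S \<in> F. a \<notin> S}"
  define Q where "Q = (\<lambda>S. S - {a}) ` {S \<in> F. a \<in> S}"
  have 1: "card F = card P + card {S \<in> F. a \<in> S}"
    unfolding P_def using finF
    by (subst card_Un_disjoint[symmetric]) (auto intro: arg_cong[where f=card])
  have 2: "card {S \<in> F. a \<in> S} = card Q"
    unfolding Q_def by (rule card_image[symmetric]) (auto simp: inj_on_def)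
  have 3: "card P + card Q = card (P \<union> Q) + card (P \<inter> Q)"
    by (rule card_Un_Int) (use finF in \<open>auto simp: P_def Q_def\<close>)
  have 4: "P \<union> Q = F0"
  proof -
    have "(\<lambda>S. S - {a}) ` P = (\<lambda>S. S) ` P" by (rule image_cong) (auto simp: P_def)
    then have "(\<lambda>S. S - {a}) ` P = P" by simp
    moreover have "F = P \<union> {S \<in> F. a \<in> S}" unfolding P_def by blast
    then have "F0 = (\<lambda>S. S - {a}) ` P \<union> Q" unfolding F0_def Q_def by (subst image_Un[symmetric]) simp
    ultimately show ?thesis by simp
  qed
  have 5: "P \<inter> Q = F1"
  proof -
    have "S \<in> F1" if "S \<in> P" "S \<in> Q" for S
    proof -
      from that(2) obtain S' where S': "S' \<in> F" "a \<in> S'" "S = S' - {a}" unfolding Q_def by auto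
      then have "insert a S = S'" by auto
      then show ?thesis using S' that(1) insert.prems unfolding F1_def P_def by auto
    qed
    moreover have "S \<in> P \<and> S \<in> Q" if "S \<in> F1" for S
    proof -
      have "a \<notin> S" using that insert.hyps unfolding F1_def by auto
      then have "S = insert a S - {a}" by auto
      then show ?thesis using that \<open>a \<notin> S\<close> unfolding F1_def P_def Q_def by blast
    qed
    ultimately show ?thesis by auto
  qed
  have c: "card F = card F0 + card F1" using 1 2 3 4 5 by simp
  define G0 where "G0 = {B. B \<subseteq> X \<and> shatters F0 B}"
  define G1 where "G1 = {B. B \<subseteq> X \<and> shatters F1 B}"
  have fG: "finite G0" "finite G1" unfolding G0_def G1_def using insert.hyps by auto
  have "card F \<le> card G0 + card G1"
    unfolding c G0_def G1_def by (intro add_mono insert.IH F0 F1)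
  also have "card G1 = card (insert a ` G1)"
    by (rule card_image[symmetric]) (use insert.hyps in \<open>auto simp: inj_on_def G1_def\<close>)
  also have "card G0 + card (insert a ` G1) = card (G0 \<union> insert a ` G1)"
    by (rule card_Un_disjoint[symmetric]) (use fG insert.hyps in \<open>auto simp: G0_def\<close>)
  also have "\<dots> \<le> card {B. B \<subseteq> insert a X \<and> shatters F B}"
  proof (rule card_mono)
    show "finite {B. B \<subseteq> insert a X \<and> shatters F B}" using insert.hyps by auto
    show "G0 \<union> insert a ` G1 \<subseteq> {B. B \<subseteq> insert a X \<and> shatters F B}"
    proof
      fix B assume "B \<in> G0 \<union> insert a ` G1"
      then consider "B \<in> G0" | B' where "B' \<in> G1" "B = insert a B'" by auto
      then show "B \<in> {B. B \<subseteq> insert a X \<and> shatters F B}"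
      proof cases
        case 1
        have aB: "a \<notin> B" using 1 insert.hyps unfolding G0_def by blast
        have "shatters F B" unfolding shatters_def
        proof (intro allI impI)
          fix A assume "A \<subseteq> B"
          with 1 obtain S where "S \<in> F0" "S \<inter> B = A" unfolding G0_def shatters_def by blast
          then obtain S' where "S' \<in> F" "S = S' - {a}" unfolding F0_def by auto
          moreover have "S' \<inter> B = A" using \<open>S \<inter> B = A\<close> \<open>S = S' - {a}\<close> aB by auto
          ultimately show "\<exists>S\<in>F. S \<inter> B = A" by auto
        qed
        then show ?thesis using 1 unfolding G0_def by blast
      next
        case 2
        have aB: "a \<notin> B'" using 2 insert.hyps unfolding G1_def by blast
        have "shatters F B" unfolding shatters_def
        proof (intro allI impI)
          fix A assume A: "A \<subseteq> B"
          then have "A - {a} \<subseteq> B'" using 2 by auto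
          with 2 obtain S where S: "S \<in> F1" "S \<inter> B' = A - {a}" unfolding G1_def shatters_def by blast
          have aS: "a \<notin> S" using S insert.hyps unfolding F1_def by blast
          show "\<exists>S\<in>F. S \<inter> B = A"
          proof (cases "a \<in> A")
            case True
            then have "insert a S \<inter> B = A" using S aS 2 aB by auto
            then show ?thesis using S unfolding F1_def by blast
          next
            case False
            then have "S \<inter> B = A" using S aS 2 aB by auto
            then show ?thesis using S unfolding F1_def by blast
          qed
        qed
        then show ?thesis using 2 unfolding G1_def by blast
      qed
    qed
  qed
  finally show ?case .
qed

text \<open>Give each subset \<open>B\<close> the weight \<open>l ^ card B\<close>, which is at
  least \<open>l ^ D\<close> on the small ones, and sum over all subsets to get
  \<open>(1 + l) ^ card J\<close>. The weight is left free because it is tuned differently later: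
  \<open>e / 4\<close> in \<open>packing_bound\<close>, \<open>d / N\<close> in
  \<open>card_patterns\<close>.\<close>

lemma card_small_subsets_le:
  fixes l :: real
  assumes "finite J" "0 < l" "l \<le> 1"
  shows "real (card {B. B \<subseteq> J \<and> card B \<le> D}) \<le> exp (l * card J) / l ^ D"
proof -
  have "real (card {B. B \<subseteq> J \<and> card B \<le> D}) * l ^ D = (\<Sum>B | B \<subseteq> J \<and> card B \<le> D. l ^ D)"
    by simp
  also have "\<dots> \<le> (\<Sum>B | B \<subseteq> J \<and> card B \<le> D. l ^ card B)"
    by (intro sum_mono power_decreasing) (use assms in auto)
  also have "\<dots> \<le> (\<Sum>B\<in>Pow J. l ^ card B)"
    by (intro sum_mono2) (use assms in auto)
  also have "\<dots> = (1 + l) ^ card J"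
  proof -
    have "(\<Prod>x\<in>J. l + 1) = (\<Sum>B\<in>Pow J. (\<Prod>x\<in>B. l) * (\<Prod>x\<in>J-B. 1))"
      using assms by (intro prod_add) auto
    then show ?thesis by (simp add: add.commute)
  qed
  also have "\<dots> \<le> exp l ^ card J"
    using assms exp_ge_add_one_self[of l] by (intro power_mono) auto
  also have "\<dots> = exp (l * card J)" by (simp add: exp_of_nat_mult[symmetric] mult.commute)
  finally show ?thesis using assms by (simp add: field_simps)
qed

lemma sauer_exp:
  fixes l :: real
  assumes "finite J" "F \<subseteq> Pow J" "0 < l" "l \<le> 1" "\<And>B. shatters F B \<Longrightarrow> finite B \<Longrightarrow> card B \<le> D"
  shows "real (card F) \<le> exp (l * card J) / l ^ D"
proof -
  have "card F \<le> card {B. B \<subseteq> J \<and> shatters F B}"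
    by (rule card_le_shattered) fact+
  also have "\<dots> \<le> card {B. B \<subseteq> J \<and> card B \<le> D}"
    using assms by (intro card_mono) (auto dest: finite_subset)
  finally have "real (card F) \<le> real (card {B. B \<subseteq> J \<and> card B \<le> D})" by simp
  also have "\<dots> \<le> exp (l * card J) / l ^ D" by (rule card_small_subsets_le) fact+
  finally show ?thesis .
qed

text \<open>A deterministic replacement for random sampling. If every remaining set fills a fraction
  \<open>e\<close> of the \<open>N\<close> indices, double counting yields one index lying in a
  fraction \<open>e\<close> of these sets; adding it to \<open>J\<close> shrinks the unhit part by
  \<open>1 - e\<close>.\<close>

lemma greedy_hitting_set:
  fixes q :: "'b \<Rightarrow> nat set" and e :: real
  assumes "finite Q" "N \<ge> 1" "0 \<le> e" "e \<le> 1"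
    and "\<And>p. p \<in> Q \<Longrightarrow> q p \<subseteq> {..<N} \<and> e * N \<le> card (q p)"
  shows "\<exists>J\<subseteq>{..<N}. card J \<le> m \<and> real (card {p \<in> Q. q p \<inter> J = {}}) \<le> (1 - e) ^ m * card Q"
proof (induction m)
  case 0
  show ?case by (rule exI[of _ "{}"]) simp
next
  case (Suc m)
  then obtain J where J: "J \<subseteq> {..<N}" "card J \<le> m"
    "real (card {p \<in> Q. q p \<inter> J = {}}) \<le> (1 - e) ^ m * card Q" by auto
  define R where "R = {p \<in> Q. q p \<inter> J = {}}"
  have finR: "finite R" using assms unfolding R_def by auto
  have "\<exists>i<N. e * card R \<le> card {p \<in> R. i \<in> q p}"
  proof (rule ccontr)
    assume "\<not> ?thesis"
    then have lt: "\<And>i. i < N \<Longrightarrow> real (card {p \<in> R. i \<in> q p}) < e * card R" by (auto simp: not_le)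
    have "e * N * card R = (\<Sum>p\<in>R. e * N)" by simp
    also have "\<dots> \<le> (\<Sum>p\<in>R. real (card (q p)))"
      using assms by (intro sum_mono) (auto simp: R_def)
    also have "\<dots> = (\<Sum>p\<in>R. \<Sum>i<N. if i \<in> q p then 1 else 0)"
    proof (rule sum.cong[OF refl])
      fix p assume "p \<in> R"
      then have "q p \<subseteq> {..<N}" using assms unfolding R_def by auto
      then have "{..<N} \<inter> q p = q p" by auto
      then show "real (card (q p)) = (\<Sum>i<N. if i \<in> q p then 1 else 0)"
        by (simp add: sum.If_cases)
    qed
    also have "\<dots> = (\<Sum>i<N. \<Sum>p\<in>R. if i \<in> q p then 1 else 0)" by (rule sum.swap)
    also have "\<dots> = (\<Sum>i<N. real (card {p \<in> R. i \<in> q p}))"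
      using finR by (intro sum.cong refl) (auto simp: sum.If_cases intro!: arg_cong[where f=card])
    also have "\<dots> < (\<Sum>i<N. e * card R)"
      using assms lt by (intro sum_strict_mono) (auto simp: lessThan_empty_iff)
    also have "\<dots> = e * N * card R" by simp
    finally show False by simp
  qed
  then obtain i where i: "i < N" "e * card R \<le> card {p \<in> R. i \<in> q p}" by auto
  have "card {p \<in> Q. q p \<inter> insert i J = {}} + card {p \<in> R. i \<in> q p} = card R"
    using finR unfolding R_def
    by (subst card_Un_disjoint[symmetric]) (use assms in \<open>auto intro!: arg_cong[where f=card]\<close>)
  then have "real (card {p \<in> Q. q p \<inter> insert i J = {}}) = real (card R) - card {p \<in> R. i \<in> q p}"
    by linarith
  also have "\<dots> \<le> (1 - e) * card R" using i by (simp add: algebra_simps)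
  also have "\<dots> \<le> (1 - e) * ((1 - e) ^ m * card Q)"
    using J assms unfolding R_def by (intro mult_left_mono) auto
  finally have "real (card {p \<in> Q. q p \<inter> insert i J = {}}) \<le> (1 - e) ^ Suc m * card Q" by simp
  moreover have "card (insert i J) \<le> Suc m"
    using J card_insert_le_m1[of "Suc m" J i] by simp
  ultimately show ?case using J i by (intro exI[of _ "insert i J"]) auto
qed

text \<open>A small hitting set for the symmetric differences turns a separated family into one with
  distinct traces. Choosing the weight \<open>\<epsilon>/4\<close> in the Sauer bound absorbs the logarithm
  of the cardinality into a square root of the cardinality.\<close>

lemma packing_bound:
  fixes e :: real and N :: nat
  assumes T: "T \<subseteq> Pow {..<N}" and e: "0 < e" "e \<le> 1" and N: "N \<ge> 1"
    and sep: "\<And>A B. A \<in> T \<Longrightarrow> B \<in> T \<Longrightarrow> A \<noteq> B \<Longrightarrow> e * N < card (sym_diff A B)"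
    and vc: "\<And>B. shatters T B \<Longrightarrow> finite B \<Longrightarrow> card B \<le> D" and D: "D \<ge> 1"
  shows "real (card T) \<le> (8 / e) ^ (2 * D)"
proof (cases "T = {}")
  case True then show ?thesis using e by simp
next
  case False
  have finT: "finite T" by (rule finite_subset[OF T]) simp
  define M where "M = real (card T)"
  have M: "M \<ge> 1" using False finT unfolding M_def
    by (simp add: Suc_leI card_gt_0_iff)
  define Q where "Q = {(A, B). A \<in> T \<and> B \<in> T \<and> A \<noteq> B}"
  have QT: "Q \<subseteq> T \<times> T" unfolding Q_def by auto
  then have finQ: "finite Q" using finT by (meson finite_SigmaI finite_subset)
  have "card Q \<le> card (T \<times> T)" using QT finT by (intro card_mono) auto
  then have cQ: "real (card Q) \<le> M\<^sup>2" unfolding M_def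
    by (simp add: card_cartesian_product power2_eq_square flip: of_nat_mult)
  \<comment> \<open>The least integer above \<open>2 ln M / e\<close>: then
    \<open>(1 - e) ^ m * M^2 < 1\<close>, so no pair is left unhit, while \<open>m\<close> stays
    small enough for the weight \<open>e / 4\<close> to leave only \<open>sqrt M\<close> on the
    right.\<close>
  define m where "m = Suc (nat \<lfloor>2 * ln M / e\<rfloor>)"
  have l0: "0 \<le> 2 * ln M / e" using M e by simp
  have m1: "2 * ln M / e < m" and m2: "m \<le> 2 * ln M / e + 1"
    unfolding m_def using l0 by (linarith, linarith)
  have "\<exists>J\<subseteq>{..<N}. card J \<le> m \<and>
      real (card {p \<in> Q. (case p of (A, B) \<Rightarrow> sym_diff A B) \<inter> J = {}}) \<le> (1 - e) ^ m * card Q"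
  proof (rule greedy_hitting_set[OF finQ N])
    fix p assume "p \<in> Q"
    then obtain A B where p: "p = (A, B)" "A \<in> T" "B \<in> T" "A \<noteq> B" unfolding Q_def by auto
    then show "(case p of (A, B) \<Rightarrow> sym_diff A B) \<subseteq> {..<N} \<and>
        e * N \<le> card (case p of (A, B) \<Rightarrow> sym_diff A B)"
      using sep[of A B] T by auto
  qed (use e in auto)
  then obtain J where J: "J \<subseteq> {..<N}" "card J \<le> m"
    "real (card {p \<in> Q. (case p of (A, B) \<Rightarrow> sym_diff A B) \<inter> J = {}}) \<le> (1 - e) ^ m * card Q" by auto
  have finJ: "finite J" using J by (meson finite_lessThan finite_subset)
  have "(1 - e) ^ m \<le> exp (- e) ^ m"
    using e exp_ge_add_one_self[of "- e"] by (intro power_mono) auto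
  also have "\<dots> = exp (- e * m)" by (simp add: exp_of_nat_mult[symmetric] mult.commute)
  finally have "(1 - e) ^ m * card Q \<le> exp (- e * m) * M\<^sup>2"
    using cQ by (intro mult_mono) auto
  also have "M\<^sup>2 = exp (2 * ln M)" using M by (simp add: exp_double)
  also have "exp (- e * m) * exp (2 * ln M) = exp (2 * ln M - e * m)" by (simp flip: exp_add)
  also have "\<dots> < exp 0" using m1 e by (subst exp_less_cancel_iff) (simp add: field_simps)
  finally have "real (card {p \<in> Q. (case p of (A, B) \<Rightarrow> sym_diff A B) \<inter> J = {}}) < 1"
    using J(3) by simp
  then have "card {p \<in> Q. (case p of (A, B) \<Rightarrow> sym_diff A B) \<inter> J = {}} = 0" by linarith
  then have e0: "{p \<in> Q. (case p of (A, B) \<Rightarrow> sym_diff A B) \<inter> J = {}} = {}"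
    using finQ by (subst (asm) card_0_eq) auto
  have inj: "inj_on (\<lambda>A. A \<inter> J) T"
  proof (rule inj_onI, rule ccontr)
    fix A B assume "A \<in> T" "B \<in> T" "A \<inter> J = B \<inter> J" "A \<noteq> B"
    then have "(A, B) \<in> {p \<in> Q. (case p of (A, B) \<Rightarrow> sym_diff A B) \<inter> J = {}}" unfolding Q_def by auto
    then show False using e0 by auto
  qed
  define F where "F = (\<lambda>A. A \<inter> J) ` T"
  have "M = real (card F)" unfolding M_def F_def using inj by (simp add: card_image)
  also have "\<dots> \<le> exp (e / 4 * card J) / (e / 4) ^ D"
  proof (rule sauer_exp[OF finJ])
    fix B assume B: "shatters F B" "finite B"
    have "B \<subseteq> J" using B(1) unfolding shatters_def F_def by blast
    have "shatters T B" unfolding shatters_def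
    proof (intro allI impI)
      fix A assume "A \<subseteq> B"
      then obtain S where "S \<in> T" "(S \<inter> J) \<inter> B = A" using B(1) unfolding shatters_def F_def by blast
      then show "\<exists>S\<in>T. S \<inter> B = A" using \<open>B \<subseteq> J\<close> by blast
    qed
    then show "card B \<le> D" using vc B by auto
  qed (use e in \<open>auto simp: F_def\<close>)
  also have "\<dots> \<le> exp (e / 4 * m) / (e / 4) ^ D"
    using J e by (intro divide_right_mono) auto
  also have "\<dots> \<le> exp (ln M / 2 + 1 / 4) / (e / 4) ^ D"
  proof -
    have "e / 4 * m \<le> e / 4 * (2 * ln M / e + 1)" using m2 e by (intro mult_left_mono) auto
    also have "\<dots> \<le> ln M / 2 + 1 / 4" using e by (simp add: field_simps)
    finally show ?thesis using e by (intro divide_right_mono) auto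
  qed
  finally have 1: "M \<le> exp (ln M / 2 + 1 / 4) * (4 / e) ^ D" by (simp add: power_divide field_simps)
  have "M\<^sup>2 \<le> (exp (ln M / 2 + 1 / 4) * (4 / e) ^ D)\<^sup>2" using 1 M by (intro power_mono) auto
  also have "\<dots> = exp (ln M / 2 + 1 / 4) ^ 2 * (4 / e) ^ (2 * D)"
    by (simp only: power_mult_distrib power_mult[symmetric] mult.commute[of D])
  also have "exp (ln M / 2 + 1 / 4) ^ 2 = exp (ln M) * exp (1 / 2)"
    by (simp add: exp_double[symmetric] exp_add[symmetric] algebra_simps)
  also have "exp (ln M) * exp (1 / 2) * (4 / e) ^ (2 * D) = M * (exp (1 / 2) * (4 / e) ^ (2 * D))"
    using M by simp
  finally have "M \<le> exp (1 / 2) * (4 / e) ^ (2 * D)" using M by (simp add: power2_eq_square)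
  also have "\<dots> \<le> 2 ^ (2 * D) * (4 / e) ^ (2 * D)"
  proof (intro mult_right_mono)
    have "exp (1/2 :: real) \<le> exp 1" by simp
    also have "\<dots> \<le> 2 ^ 2" using exp_le by simp
    also have "\<dots> \<le> (2::real) ^ (2 * D)" using D by (intro power_increasing) auto
    finally show "exp (1/2 :: real) \<le> 2 ^ (2 * D)" .
  qed (use e in auto)
  also have "\<dots> = (8 / e) ^ (2 * D)" by (simp add: power_mult_distrib[symmetric])
  finally show ?thesis unfolding M_def .
qed

text \<open>A separated subfamily of greatest cardinality is a net, since an uncovered member could
  be added to it. Being a subfamily, it shatters no new set, so \<open>packing_bound\<close> applies
  to it.\<close>

lemma exists_net:
  fixes e :: real and N :: nat
  assumes F: "F \<subseteq> Pow {..<N}" and e: "0 < e" "e \<le> 1" and N: "N \<ge> 1"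
    and vc: "\<And>B. shatters F B \<Longrightarrow> finite B \<Longrightarrow> card B \<le> D" and D: "D \<ge> 1"
  shows "\<exists>T\<subseteq>F. real (card T) \<le> (8 / e) ^ (2 * D) \<and> (\<forall>A\<in>F. \<exists>B\<in>T. card (sym_diff A B) \<le> e * N)"
proof -
  define sep where "sep T \<longleftrightarrow> T \<subseteq> F \<and> (\<forall>A\<in>T. \<forall>B\<in>T. A \<noteq> B \<longrightarrow> e * N < card (sym_diff A B))" for T
  have finF: "finite F" by (rule finite_subset[OF F]) simp
  have "\<exists>T. sep T \<and> (\<forall>T'. sep T' \<longrightarrow> card T' \<le> card T)"
    by (rule ex_has_greatest_nat[where k="{}" and b="Suc (card F)"])
       (use finF in \<open>auto simp: sep_def less_Suc_eq_le intro: card_mono\<close>)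
  then obtain T where T: "sep T" "\<And>T'. sep T' \<Longrightarrow> card T' \<le> card T" by auto
  have TF: "T \<subseteq> F" using T unfolding sep_def by auto
  have finT: "finite T" using TF finF finite_subset by auto
  have "\<exists>B\<in>T. card (sym_diff A B) \<le> e * N" if "A \<in> F" for A
  proof (rule ccontr)
    assume n: "\<not> ?thesis"
    have "A \<notin> T"
    proof
      assume "A \<in> T"
      then have "\<not> real (card (sym_diff A A)) \<le> e * N" using n by blast
      then show False using e by simp
    qed
    have "sep (insert A T)" using T(1) that n unfolding sep_def by (auto simp: not_le Un_commute)
    then show False using T(2)[of "insert A T"] finT \<open>A \<notin> T\<close> by simp
  qed
  moreover have "real (card T) \<le> (8 / e) ^ (2 * D)"
  proof (rule packing_bound[OF _ e N])
    fix B assume "shatters T B" "finite B"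
    moreover have "shatters F B" using \<open>shatters T B\<close> TF unfolding shatters_def by (meson subsetD)
    ultimately show "card B \<le> D" using vc by auto
  qed (use T(1) F D in \<open>auto simp: sep_def\<close>)
  ultimately show ?thesis using TF by auto
qed

section \<open>VC dimension of the activation patterns\<close>

text \<open>Stated for an indexed family, so that repeated vectors count as dependent. The induction
  is Gaussian elimination of the last coordinate.\<close>

lemma exists_linear_dependence:
  fixes u :: "'a \<Rightarrow> nat \<Rightarrow> real"
  assumes "finite J" "card J > D"
  shows "\<exists>l. (\<exists>i\<in>J. l i \<noteq> 0) \<and> (\<forall>j<D. (\<Sum>i\<in>J. l i * u i j) = 0)"
  using assms
proof (induction D arbitrary: J u)
  case 0
  then obtain i where "i \<in> J" by (metis card.empty ex_in_conv less_irrefl)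
  then show ?case by (intro exI[of _ "\<lambda>_. 1"]) auto
next
  case (Suc D)
  show ?case
  proof (cases "\<forall>i\<in>J. u i D = 0")
    case True
    obtain l where l: "\<exists>i\<in>J. l i \<noteq> 0" "\<forall>j<D. (\<Sum>i\<in>J. l i * u i j) = 0"
      using Suc.IH[of J u] Suc.prems by auto
    show ?thesis
    proof (intro exI[of _ l] conjI allI impI)
      fix j assume "j < Suc D"
      then show "(\<Sum>i\<in>J. l i * u i j) = 0"
        using l True by (cases "j = D") auto
    qed (use l in auto)
  next
    case False
    then obtain k where k: "k \<in> J" "u k D \<noteq> 0" by auto
    define w where "w i j = u i j - u i D / u k D * u k j" for i j
    have "card (J - {k}) > D" using Suc.prems k by simp
    then obtain l where l: "\<exists>i\<in>J-{k}. l i \<noteq> 0" "\<forall>j<D. (\<Sum>i\<in>J-{k}. l i * w i j) = 0"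
      using Suc.IH[of "J - {k}" w] Suc.prems by auto
    \<comment> \<open>The coefficient of the pivot \<open>k\<close> that makes the combination of
      the original vectors equal to the combination of the reduced vectors \<open>w\<close>.\<close>
    define c where "c = - (\<Sum>i\<in>J-{k}. l i * (u i D / u k D))"
    have eq: "(\<Sum>i\<in>J. (if i = k then c else l i) * u i j) = (\<Sum>i\<in>J-{k}. l i * w i j)" for j
    proof -
      have "(\<Sum>i\<in>J. (if i = k then c else l i) * u i j)
          = c * u k j + (\<Sum>i\<in>J-{k}. (if i = k then c else l i) * u i j)"
        using Suc.prems k by (subst sum.remove[of _ k]) auto
      also have "(\<Sum>i\<in>J-{k}. (if i = k then c else l i) * u i j) = (\<Sum>i\<in>J-{k}. l i * u i j)"
        by (intro sum.cong) auto
      also have "c * u k j + \<dots> = (\<Sum>i\<in>J-{k}. l i * w i j)"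
        unfolding c_def w_def by (simp add: sum_distrib_left sum_subtractf algebra_simps)
      finally show ?thesis .
    qed
    show ?thesis
    proof (intro exI[of _ "\<lambda>i. if i = k then c else l i"] conjI allI impI)
      show "\<exists>i\<in>J. (if i = k then c else l i) \<noteq> 0" using l by auto
      fix j assume "j < Suc D"
      then consider "j < D" | "j = D" by linarith
      then show "(\<Sum>i\<in>J. (if i = k then c else l i) * u i j) = 0"
      proof cases
        case 2
        then show ?thesis unfolding eq w_def using k by simp
      qed (use l in \<open>simp add: eq\<close>)
    qed
  qed
qed

text \<open>The strict inequality sets the formal derivative of ReLU to 0 at the kink, in agreement
  with the integrand of \<open>relu_diff_integral\<close>.\<close>

definition active :: "nat \<Rightarrow> nat \<Rightarrow> (nat \<times> nat \<Rightarrow> real) \<Rightarrow> (nat \<Rightarrow> real) \<Rightarrow> (nat \<Rightarrow> real) \<Rightarrow> nat set" where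
  "active d N W b x = {i. i < N \<and> (\<Sum>j<d. W (i, j) * x j) + b i > 0}"

text \<open>Row \<open>i\<close> together with its bias is a vector of length \<open>d + 1\<close>,
  paired with \<open>x\<close> extended by a coordinate 1. Among more than \<open>d + 1\<close> rows
  there is a linear relation \<open>l\<close>. Shattering would provide a point whose active rows
  are exactly those with positive coefficient, and then the relation, which must evaluate to 0, is
  positive there.\<close>

lemma active_vc:
  assumes "shatters (range (active d N W b)) B" "finite B"
  shows "card B \<le> d + 1"
proof (rule ccontr)
  assume "\<not> ?thesis"
  then have "card B > d + 1" by simp
  define u where "u i j = (if j < d then W (i, j) else b i)" for i j
  obtain l where l: "\<exists>i\<in>B. l i \<noteq> 0" "\<forall>j<d+1. (\<Sum>i\<in>B. l i * u i j) = 0"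
    using exists_linear_dependence[of B "d + 1" u] \<open>card B > d + 1\<close> assms by auto
  define f where "f x i = (\<Sum>j<d. W (i, j) * x j) + b i" for x i
  have f: "f x i = (\<Sum>j<d+1. u i j * (if j < d then x j else 1))" for x i
    unfolding f_def u_def by simp
  have z: "(\<Sum>i\<in>B. l i * f x i) = 0" for x
  proof -
    have "(\<Sum>i\<in>B. l i * f x i) = (\<Sum>i\<in>B. \<Sum>j<d+1. (l i * u i j) * (if j < d then x j else 1))"
      unfolding f sum_distrib_left by (simp add: mult.assoc)
    also have "\<dots> = (\<Sum>j<d+1. (\<Sum>i\<in>B. l i * u i j) * (if j < d then x j else 1))"
      by (subst sum.swap) (simp add: sum_distrib_right)
    also have "\<dots> = 0" by (rule sum.neutral) (use l(2) in simp)
    finally show ?thesis .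
  qed
  \<comment> \<open>Inactive rows contribute only nonnegative terms, possibly 0, so the relation is
    oriented to have at least one positive coefficient, hence one strictly positive term.\<close>
  obtain s :: real where s: "s = 1 \<or> s = -1" "\<exists>i\<in>B. s * l i > 0"
  proof -
    from l obtain i where "i \<in> B" "l i \<noteq> 0" by auto
    then show ?thesis using that[of 1] that[of "-1"] by (cases "l i > 0") force+
  qed
  have "{i\<in>B. s * l i > 0} \<subseteq> B" by auto
  then obtain x where x: "active d N W b x \<inter> B = {i\<in>B. s * l i > 0}"
    using assms(1) unfolding shatters_def by (metis (no_types, lifting) rangeE)
  have BN: "B \<subseteq> {..<N}"
  proof -
    obtain S where "S \<in> range (active d N W b)" "S \<inter> B = B" using assms(1) unfolding shatters_def by blast
    then show ?thesis unfolding active_def by auto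
  qed
  have pos: "f x i > 0 \<longleftrightarrow> s * l i > 0" if "i \<in> B" for i
    using x that BN unfolding active_def f_def by auto
  obtain i0 where i0: "i0 \<in> B" "s * l i0 > 0" using s by auto
  have "0 < (\<Sum>i\<in>B. s * l i * f x i)"
  proof (rule sum_pos2[OF assms(2) i0(1)])
    show "0 < s * l i0 * f x i0" using i0 pos by auto
    show "0 \<le> s * l i * f x i" if "i \<in> B" for i
      using pos[OF that] by (cases "f x i > 0") (auto simp: not_less intro: mult_nonpos_nonpos)
  qed
  also have "\<dots> = s * (\<Sum>i\<in>B. l i * f x i)" by (simp add: sum_distrib_left mult.assoc)
  finally show False using z by simp
qed

lemma active_subset: "active d N W b x \<subseteq> {..<N}"
  by (auto simp: active_def)

subsection \<open>Lipschitz constants and activation patterns\<close>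

text \<open>After scaling, the points of the lattice with mesh \<open>1 / (2 sqrt d)\<close> in the
  unit ball. With an explicit lattice the cardinality is a combinatorial sum and no volume
  comparison is involved. Coordinates from \<open>d\<close> on are fixed to make the set
  finite.\<close>

definition grid :: "nat \<Rightarrow> (nat \<Rightarrow> int) set" where
  "grid d = {z. (\<forall>j\<ge>d. z j = 0) \<and> (\<Sum>j<d. (z j)\<^sup>2) \<le> 4 * int d}"

definition net :: "nat \<Rightarrow> (nat \<Rightarrow> real) set" where
  "net d = (\<lambda>z j. real_of_int (z j) / (2 * sqrt d)) ` grid d"

lemma sum_half_power_abs: "(\<Sum>z\<in>{- int m..int m}. (1/2::real) ^ nat \<bar>z\<bar>) = 3 - 2 * (1/2) ^ m"
proof (induction m)
  case (Suc m)
  have "{- int (Suc m)..int (Suc m)} = insert (- int (Suc m)) (insert (int (Suc m)) {- int m..int m})"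
    by auto
  then show ?case using Suc by (simp add: nat_add_distrib)
qed simp

text \<open>For integers \<open>|z| <= z^2\<close>, so the 1-norm of a grid point is at most
  \<open>4 d\<close> and \<open>1 <= 2^(4 d) * 2^(-|z|)\<close> for that norm. The sum of the
  right-hand side over a box factorises over the coordinates, each factor being below 3, which gives
  \<open>(16 * 3)^d\<close>.\<close>

lemma grid_bound: assumes "d \<ge> 1" shows "finite (grid d)" "real (card (grid d)) \<le> 48 ^ d"
proof -
  define Z where "Z = (\<Pi>\<^sub>E j\<in>{..<d}. {- int (2 * d)..int (2 * d)})"
  define Z' where "Z' = {z \<in> Z. (\<Sum>j<d. (z j)\<^sup>2) \<le> 4 * int d}"
  have finZ: "finite Z" unfolding Z_def by (intro finite_PiE) auto
  have sub: "(\<lambda>z. restrict z {..<d}) ` grid d \<subseteq> Z'"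
  proof safe
    fix z assume z: "z \<in> grid d"
    have "z j \<in> {- int (2 * d)..int (2 * d)}" if "j < d" for j
    proof -
      have "(z j)\<^sup>2 \<le> (\<Sum>j<d. (z j)\<^sup>2)" by (rule member_le_sum) (use that in auto)
      also have "\<dots> \<le> 4 * int d" using z unfolding grid_def by simp
      also have "\<dots> \<le> (int (2 * d))\<^sup>2" using assms by (simp add: power2_eq_square)
      finally show ?thesis using abs_le_square_iff[of "z j" "int (2 * d)"] by auto
    qed
    then show "restrict z {..<d} \<in> Z'" using z unfolding Z'_def Z_def grid_def by auto
  qed
  have inj: "inj_on (\<lambda>z. restrict z {..<d}) (grid d)"
  proof (rule inj_onI, rule ext)
    fix z w j assume "z \<in> grid d" "w \<in> grid d" "restrict z {..<d} = restrict w {..<d}"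
    then show "z j = w j" by (cases "j < d") (auto simp: grid_def restrict_def fun_eq_iff dest: spec[of _ j])
  qed
  have finZ': "finite Z'" using finZ unfolding Z'_def by auto
  then show "finite (grid d)" using finite_imageD[OF finite_subset[OF sub] inj] by auto
  have "card (grid d) = card ((\<lambda>z. restrict z {..<d}) ` grid d)" using inj by (simp add: card_image)
  also have "\<dots> \<le> card Z'" by (rule card_mono[OF finZ' sub])
  finally have "real (card (grid d)) \<le> (\<Sum>z\<in>Z'. 1)" by simp
  also have "\<dots> \<le> (\<Sum>z\<in>Z'. 2 ^ (4 * d) * (\<Prod>j<d. (1/2) ^ nat \<bar>z j\<bar>))"
  proof (rule sum_mono)
    fix z assume "z \<in> Z'"
    have "int (\<Sum>j<d. nat \<bar>z j\<bar>) = (\<Sum>j<d. \<bar>z j\<bar>)" by simp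
    also have "\<dots> \<le> (\<Sum>j<d. (z j)\<^sup>2)"
    proof (rule sum_mono)
      fix j
      have "\<bar>z j\<bar> * 1 \<le> \<bar>z j\<bar> * \<bar>z j\<bar>" by (cases "z j = 0") (auto simp del: abs_mult_self_eq intro!: mult_left_mono)
      then show "\<bar>z j\<bar> \<le> (z j)\<^sup>2" by (simp add: power2_eq_square)
    qed
    also have "\<dots> \<le> int (4 * d)" using \<open>z \<in> Z'\<close> unfolding Z'_def by simp
    finally have le: "(\<Sum>j<d. nat \<bar>z j\<bar>) \<le> 4 * d" by linarith
    have "(1::real) = 2 ^ (4 * d) * (1/2) ^ (4 * d)" by (simp add: power_one_over)
    also have "\<dots> \<le> 2 ^ (4 * d) * (1/2) ^ (\<Sum>j<d. nat \<bar>z j\<bar>)"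
      by (intro mult_left_mono power_decreasing le) auto
    also have "\<dots> = 2 ^ (4 * d) * (\<Prod>j<d. (1/2) ^ nat \<bar>z j\<bar>)" by (simp add: power_sum)
    finally show "(1::real) \<le> 2 ^ (4 * d) * (\<Prod>j<d. (1/2) ^ nat \<bar>z j\<bar>)" .
  qed
  also have "\<dots> \<le> (\<Sum>z\<in>Z. 2 ^ (4 * d) * (\<Prod>j<d. (1/2) ^ nat \<bar>z j\<bar>))"
    by (intro sum_mono2 finZ) (auto simp: Z'_def intro!: prod_nonneg mult_nonneg_nonneg)
  also have "\<dots> = 2 ^ (4 * d) * (\<Sum>z\<in>Z. \<Prod>j<d. (1/2) ^ nat \<bar>z j\<bar>)"
    by (rule sum_distrib_left[symmetric])
  also have "(\<Sum>z\<in>Z. \<Prod>j<d. (1/2::real) ^ nat \<bar>z j\<bar>)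
      = (\<Prod>j<d. \<Sum>z\<in>{- int (2 * d)..int (2 * d)}. (1/2::real) ^ nat \<bar>z\<bar>)"
    unfolding Z_def by (rule prod_sum_PiE[symmetric]) auto
  also have "2 ^ (4 * d) * (\<Prod>j<d. \<Sum>z\<in>{- int (2 * d)..int (2 * d)}. (1/2::real) ^ nat \<bar>z\<bar>)
      \<le> 2 ^ (4 * d) * (\<Prod>j<d. 3)"
    unfolding sum_half_power_abs
  proof (intro mult_left_mono prod_mono conjI)
    have "(1/2::real) ^ (2 * d) \<le> 1" by (intro power_le_one) auto
    then show "0 \<le> 3 - 2 * (1/2::real) ^ (2 * d)" by linarith
  qed simp_all
  also have "2 ^ (4 * d) * (\<Prod>j<d. 3) = (48::real) ^ d" by (simp add: power_mult power_mult_distrib[symmetric])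
  finally show "real (card (grid d)) \<le> 48 ^ d" .
qed

lemma finite_net: "d \<ge> 1 \<Longrightarrow> finite (net d)"
  unfolding net_def by (intro finite_imageI grid_bound)

lemma card_net: assumes "d \<ge> 1" shows "real (card (net d)) \<le> exp (4 * real d)"
proof -
  have "real (card (net d)) \<le> real (card (grid d))"
    unfolding net_def using grid_bound(1)[OF assms] by (simp add: card_image_le)
  also have "\<dots> \<le> 48 ^ d" by (rule grid_bound(2)[OF assms])
  also have "(48::real) ^ d \<le> exp 4 ^ d"
  proof (intro power_mono)
    \<comment> \<open>Four Taylor terms of \<open>exp (1/2)\<close>, raised to the eighth power,
      already exceed 48.\<close>
    have "(1 + 1/2 + 1/8 + 1/48 :: real) ^ 8 \<le> exp (1/2) ^ 8"
    proof (intro power_mono)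
      have "(\<Sum>k<4. (1/2::real) ^ k /\<^sub>R fact k) \<le> exp (1/2)"
        unfolding exp_def by (intro sum_le_suminf summable_exp_generic) (auto simp: scaleR_conv_of_real)
      then show "(1 + 1/2 + 1/8 + 1/48 :: real) \<le> exp (1/2)"
        by (simp add: eval_nat_numeral fact_numeral)
    qed auto
    also have "exp (1/2::real) ^ 8 = exp 4" by (simp add: exp_of_nat_mult[symmetric])
    finally show "(48::real) \<le> exp 4" by (rule order_trans[rotated]) (simp add: power_divide)
  qed auto
  also have "exp 4 ^ d = exp (4 * real d)" by (simp add: exp_of_nat_mult[symmetric] mult.commute)
  finally show ?thesis .
qed

lemma net_norm_le: assumes "v \<in> net d" "d \<ge> 1" shows "(\<Sum>j<d. (v j)\<^sup>2) \<le> 1"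
proof -
  obtain z where z: "z \<in> grid d" "v = (\<lambda>j. real_of_int (z j) / (2 * sqrt d))"
    using assms unfolding net_def by auto
  have "real_of_int (\<Sum>j<d. (z j)\<^sup>2) \<le> real_of_int (4 * int d)"
    using z(1) unfolding grid_def by (simp only: of_int_le_iff) simp
  then have "(\<Sum>j<d. (real_of_int (z j))\<^sup>2) \<le> 4 * real d" by simp
  then show ?thesis using assms(2) unfolding z(2)
    by (simp add: power_divide power_mult_distrib sum_divide_distrib[symmetric])
qed

definition trunc :: "real \<Rightarrow> int" where
  "trunc t = (if t \<ge> 0 then \<lfloor>t\<rfloor> else \<lceil>t\<rceil>)"

lemma trunc:
  fixes t :: real
  shows "\<bar>real_of_int (trunc t)\<bar> \<le> \<bar>t\<bar>" "t\<^sup>2 - \<bar>t\<bar> \<le> trunc t * t"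
proof -
  show "\<bar>real_of_int (trunc t)\<bar> \<le> \<bar>t\<bar>" 
  proof (cases "t \<ge> 0")
    case True
    then have "0 \<le> real_of_int \<lfloor>t\<rfloor>" by simp
    then show ?thesis using True unfolding trunc_def by simp
  next
    case False
    then have "real_of_int \<lceil>t\<rceil> \<le> 0" by simp
    then show ?thesis using False unfolding trunc_def by simp
  qed
  show "t\<^sup>2 - \<bar>t\<bar> \<le> trunc t * t"
  proof (cases "t \<ge> 0")
    case True
    then have "t - 1 \<le> real_of_int (trunc t)" unfolding trunc_def by simp
    then have "(t - 1) * t \<le> trunc t * t" using True by (intro mult_right_mono)
    then show ?thesis using True by (simp add: power2_eq_square algebra_simps)
  next
    case False
    then have "real_of_int (trunc t) \<le> t + 1" unfolding trunc_def by simp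
    then have "(t + 1) * t \<le> trunc t * t" using False by (intro mult_right_mono_neg) auto
    then show ?thesis using False by (simp add: power2_eq_square algebra_simps)
  qed
qed

text \<open>Truncating \<open>2 \<surd>d y / \<parallel>y\<parallel>\<close> towards zero does not increase the norm and keeps at least
  half of the inner product with \<open>y\<close>.\<close>

lemma net_norming:
  assumes d: "d \<ge> 1"
  shows "\<exists>v\<in>net d. sqrt (\<Sum>j<d. (y j)\<^sup>2) \<le> 2 * (\<Sum>j<d. v j * y j)"
proof (cases "(\<Sum>j<d. (y j)\<^sup>2) = 0")
  case True
  have "(\<lambda>_. 0) \<in> grid d" unfolding grid_def by simp
  then have "(\<lambda>_. 0) \<in> net d" unfolding net_def by (force simp: image_iff)
  then show ?thesis using True by (intro bexI[of _ "\<lambda>_. 0"]) auto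
next
  case False
  define r where "r = sqrt (\<Sum>j<d. (y j)\<^sup>2)"
  have S0: "(\<Sum>j<d. (y j)\<^sup>2) \<ge> 0" by (intro sum_nonneg) auto
  then have r: "r > 0" and r2: "r\<^sup>2 = (\<Sum>j<d. (y j)\<^sup>2)" using False unfolding r_def by auto
  define c where "c = 2 * sqrt d"
  have c: "c > 0" "c\<^sup>2 = 4 * real d" using d unfolding c_def by (auto simp: power_mult_distrib)
  define t where "t j = c * y j / r" for j
  have st: "(\<Sum>j<d. (t j)\<^sup>2) = 4 * real d"
    unfolding t_def using r c
    by (simp add: power_divide power_mult_distrib sum_distrib_left[symmetric] sum_divide_distrib[symmetric] r2[symmetric])
  define z where "z j = (if j < d then trunc (t j) else 0)" for j
  have "real_of_int (\<Sum>j<d. (z j)\<^sup>2) = (\<Sum>j<d. (real_of_int (trunc (t j)))\<^sup>2)" unfolding z_def by simp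
  also have "\<dots> \<le> (\<Sum>j<d. (t j)\<^sup>2)"
    by (intro sum_mono) (use trunc(1) in \<open>simp add: abs_le_square_iff[symmetric]\<close>)
  also have "\<dots> = real_of_int (4 * int d)" using st by simp
  finally have "z \<in> grid d" unfolding grid_def of_int_le_iff by (simp add: z_def)
  \<comment> \<open>The rounding loss is at most the 1-norm of \<open>t\<close>, and
    \<open>|t| <= t^2 / 4 + 1\<close> bounds it by \<open>d + d\<close>. This is half of the squared
    norm \<open>4 d\<close>; the factor 2 in the scaling \<open>c\<close> is chosen for
    that.\<close>
  have "4 * real d - 2 * real d \<le> (\<Sum>j<d. (t j)\<^sup>2) - (\<Sum>j<d. \<bar>t j\<bar>)"
  proof -
    have "(\<Sum>j<d. \<bar>t j\<bar>) \<le> (\<Sum>j<d. (t j)\<^sup>2 / 4 + 1)"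
    proof (rule sum_mono)
      fix j
      have "0 \<le> (\<bar>t j\<bar> / 2 - 1)\<^sup>2" by simp
      then show "\<bar>t j\<bar> \<le> (t j)\<^sup>2 / 4 + 1" by (simp add: power2_diff power_divide)
    qed
    also have "\<dots> = 2 * real d" using st by (simp add: sum.distrib sum_divide_distrib[symmetric])
    finally show ?thesis using st by simp
  qed
  also have "\<dots> \<le> (\<Sum>j<d. z j * t j)"
    unfolding sum_subtractf[symmetric] by (intro sum_mono) (simp add: z_def trunc)
  finally have zt: "2 * real d \<le> (\<Sum>j<d. z j * t j)" by simp
  have "2 * (\<Sum>j<d. (z j / c) * y j) = 2 * r / c\<^sup>2 * (\<Sum>j<d. z j * t j)"
    unfolding t_def sum_distrib_left using r c(1) by (intro sum.cong) (auto simp: power2_eq_square field_simps)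
  also have "\<dots> \<ge> 2 * r / c\<^sup>2 * (2 * real d)" using r by (intro mult_left_mono zt) auto
  also have "2 * r / c\<^sup>2 * (2 * real d) = r" using c d by simp
  finally have "r \<le> 2 * (\<Sum>j<d. (z j / c) * y j)" .
  moreover have "(\<lambda>j. real_of_int (z j) / c) \<in> net d"
    unfolding net_def c_def using \<open>z \<in> grid d\<close> by blast
  ultimately show ?thesis unfolding r_def by (rule bexI[of _ "\<lambda>j. real_of_int (z j) / c"])
qed

section \<open>From the formal gradient to the Lipschitz constant\<close>

lemma relu_diff_integral:
  "((\<lambda>t. if a + t * (b - a) > 0 then b - a else 0) has_integral relu b - relu a) {0..1}"
proof -
  define F where "F t = relu (a + t * (b - a))" for t
  have "((\<lambda>t. if a + t * (b - a) > 0 then b - a else 0) has_integral F 1 - F 0) {0..1}"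
  \<comment> \<open>The exceptional point is the kink. For \<open>b = a\<close> the quotient is 0 by
    convention and \<open>F\<close> is constant, so a vanishing argument away from that point can
    only mean \<open>b = a\<close>.\<close>
  proof (rule fundamental_theorem_of_calculus_strong[of "{- a / (b - a)}"])
    show "continuous_on {0..1} F" unfolding F_def relu_def by (intro continuous_intros)
    fix t assume t: "t \<in> {0..1} - {- a / (b - a)}"
    have op1: "open {s. a + s * (b - a) > 0}" and op2: "open {s. a + s * (b - a) < 0}"
      by (intro open_Collect_less continuous_intros)+
    consider "a + t * (b - a) > 0" | "a + t * (b - a) < 0" | "a + t * (b - a) = 0" by linarith
    then show "(F has_vector_derivative (if a + t * (b - a) > 0 then b - a else 0)) (at t)"
    proof cases
      case 1
      have "((\<lambda>s. a + s * (b - a)) has_vector_derivative b - a) (at t)"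
        by (auto intro!: derivative_eq_intros)
      then have "(F has_vector_derivative b - a) (at t)"
        by (rule has_vector_derivative_transform_within_open[OF _ op1]) (use 1 in \<open>simp_all add: F_def relu_def\<close>)
      then show ?thesis using 1 by simp
    next
      case 2
      have "((\<lambda>s. 0::real) has_vector_derivative 0) (at t)" by simp
      then have "(F has_vector_derivative 0) (at t)"
        by (rule has_vector_derivative_transform_within_open[OF _ op2]) (use 2 in \<open>simp_all add: F_def relu_def\<close>)
      then show ?thesis using 2 by simp
    next
      case 3
      have "b = a"
      proof (rule ccontr)
        assume "b \<noteq> a"
        then have "t = - a / (b - a)" using 3 by (simp add: field_simps)
        then show False using t by simp
      qed
      then show ?thesis unfolding F_def by simp
    qed
  qed auto
  then show ?thesis unfolding F_def by simp
qed

lemma dist_Rd_pos: assumes "x \<in> Rd d" "y \<in> Rd d" "x \<noteq> y" shows "dist_Rd d x y > 0"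
proof -
  obtain j where j: "x j \<noteq> y j" using assms by auto
  then have "j < d" using assms unfolding Rd_def by (cases "j < d") auto
  have "0 < (\<Sum>j<d. (x j - y j)\<^sup>2)"
    by (rule sum_pos2[of _ j]) (use j \<open>j < d\<close> in auto)
  then show ?thesis unfolding dist_Rd_def by simp
qed

text \<open>The hypothesis concerns the formal gradient at every \<open>x\<close>, kinks included,
  so no statement about differentiability almost everywhere is involved: each segment is integrated
  separately. The factor 2 is the loss of \<open>net_norming\<close>. One-sided bounds suffice, as
  the two end points may be exchanged.\<close>

lemma Lip_shallow_net_le:
  assumes d: "d \<ge> 1"
    and bd: "\<And>x v. v \<in> net d \<Longrightarrow>
      2 * (\<Sum>i\<in>active d N W0 b0 x. W1 i * (\<Sum>j<d. W0 (i, j) * v j)) \<le> B"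
  shows "Lip d (shallow_net d N (W0, W1, b0, b1)) \<le> ennreal B"
proof -
  let ?f = "shallow_net d N (W0, W1, b0, b1)"
  \<comment> \<open>Norming turns the bounds in the finitely many directions into a bound on the
    norm of the gradient \<open>G\<close>; Cauchy-Schwarz then returns to an arbitrary direction
    \<open>w\<close>.\<close>
  have grad: "(\<Sum>i\<in>active d N W0 b0 x. W1 i * (\<Sum>j<d. W0 (i, j) * w j)) \<le> B * sqrt (\<Sum>j<d. (w j)\<^sup>2)" for x w
  proof -
    define G where "G j = (\<Sum>i\<in>active d N W0 b0 x. W1 i * W0 (i, j))" for j
    have lin: "(\<Sum>i\<in>active d N W0 b0 x. W1 i * (\<Sum>j<d. W0 (i, j) * u j)) = (\<Sum>j<d. u j * G j)" for u
      unfolding G_def sum_distrib_left by (subst sum.swap) (simp add: mult_ac)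
    obtain v where v: "v \<in> net d" "sqrt (\<Sum>j<d. (G j)\<^sup>2) \<le> 2 * (\<Sum>j<d. v j * G j)"
      using net_norming[OF d] by blast
    have G: "sqrt (\<Sum>j<d. (G j)\<^sup>2) \<le> B" using v(2) bd[OF v(1), of x] unfolding lin by linarith
    have "(\<Sum>j<d. w j * G j) \<le> sqrt ((\<Sum>j<d. w j * G j)\<^sup>2)" by simp
    also have "\<dots> \<le> sqrt ((\<Sum>j<d. (w j)\<^sup>2) * (\<Sum>j<d. (G j)\<^sup>2))"
      by (intro real_sqrt_le_mono Cauchy_Schwarz_ineq_sum)
    also have "\<dots> = sqrt (\<Sum>j<d. (w j)\<^sup>2) * sqrt (\<Sum>j<d. (G j)\<^sup>2)" by (simp add: real_sqrt_mult)
    also have "\<dots> \<le> sqrt (\<Sum>j<d. (w j)\<^sup>2) * B" using G by (intro mult_left_mono) (auto intro: sum_nonneg)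
    finally show ?thesis unfolding lin by (simp add: mult.commute)
  qed
  have diff: "?f x - ?f y \<le> B * dist_Rd d x y" for x y
  proof -
    define p where "p t j = y j + t * (x j - y j)" for t j
    define A where "A i = (\<Sum>j<d. W0 (i, j) * y j) + b0 i" for i
    define C where "C i = (\<Sum>j<d. W0 (i, j) * x j) + b0 i" for i
    have CA: "C i - A i = (\<Sum>j<d. W0 (i, j) * (x j - y j))" for i
      unfolding A_def C_def by (simp add: sum_subtractf right_diff_distrib)
    have pt: "(\<Sum>j<d. W0 (i, j) * p t j) + b0 i = A i + t * (C i - A i)" for i t
      unfolding CA unfolding A_def p_def by (simp add: sum.distrib sum_distrib_left sum_subtractf algebra_simps)
    have "((\<lambda>t. \<Sum>i<N. W1 i * (if A i + t * (C i - A i) > 0 then C i - A i else 0))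
        has_integral (\<Sum>i<N. W1 i * (relu (C i) - relu (A i)))) {0..1}"
      by (intro has_integral_sum has_integral_mult_right relu_diff_integral) auto
    moreover have "(\<Sum>i<N. W1 i * (relu (C i) - relu (A i))) = ?f x - ?f y"
      unfolding shallow_net_def A_def C_def by (simp add: sum_subtractf right_diff_distrib)
    ultimately have int: "((\<lambda>t. \<Sum>i<N. W1 i * (if A i + t * (C i - A i) > 0 then C i - A i else 0))
        has_integral (?f x - ?f y)) {0..1}" by simp
    have const: "((\<lambda>t::real. B * dist_Rd d x y) has_integral (B * dist_Rd d x y)) {0..1}"
      using has_integral_const_real[of "B * dist_Rd d x y" 0 1] by simp
    show ?thesis
    proof (rule has_integral_le[OF int const])
      fix t :: real
      have "(\<Sum>i<N. W1 i * (if A i + t * (C i - A i) > 0 then C i - A i else 0))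
          = (\<Sum>i<N. if i \<in> active d N W0 b0 (p t) then W1 i * (C i - A i) else 0)"
        unfolding active_def pt by (intro sum.cong) auto
      also have "\<dots> = (\<Sum>i\<in>active d N W0 b0 (p t). W1 i * (C i - A i))"
        using active_subset[of d N W0 b0 "p t"] by (simp add: sum.If_cases inf.absorb2)
      also have "\<dots> \<le> B * dist_Rd d x y"
        unfolding CA dist_Rd_def by (rule grad)
      finally show "(\<Sum>i<N. W1 i * (if A i + t * (C i - A i) > 0 then C i - A i else 0)) \<le> B * dist_Rd d x y" .
    qed
  qed
  show ?thesis unfolding Lip_def
  proof (rule SUP_least, clarify)
    fix x y assume xy: "x \<in> Rd d" "y \<in> Rd d" "x \<noteq> y"
    have sym: "dist_Rd d y x = dist_Rd d x y" unfolding dist_Rd_def by (simp add: power2_commute)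
    have "\<bar>?f x - ?f y\<bar> \<le> B * dist_Rd d x y"
      using diff[of x y] diff[of y x] unfolding sym by linarith
    then have "\<bar>?f x - ?f y\<bar> / dist_Rd d x y \<le> B"
      using dist_Rd_pos[OF xy] by (simp add: field_simps)
    then show "ennreal (\<bar>?f (fst (x, y)) - ?f (snd (x, y))\<bar> / dist_Rd d (fst (x, y)) (snd (x, y))) \<le> ennreal B"
      by (simp add: ennreal_leI)
  qed
qed

section \<open>Measurability of the Lipschitz constant\<close>

definition rat_pairs :: "nat \<Rightarrow> ((nat \<Rightarrow> real) \<times> (nat \<Rightarrow> real)) set" where
  "rat_pairs d = {(x, y). x \<in> Rd d \<and> y \<in> Rd d \<and> x \<noteq> y \<and> range x \<subseteq> \<rat> \<and> range y \<subseteq> \<rat>}"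

lemma countable_rat_pairs: "countable (rat_pairs d)"
proof -
  define E where "E = (\<lambda>x j. if j < d then x j else 0::real) ` (\<Pi>\<^sub>E j\<in>{..<d}. (\<rat>::real set))"
  have cE: "countable E" unfolding E_def by (intro countable_image countable_PiE) (auto simp: countable_rat)
  have "x \<in> E" if "x \<in> Rd d" "range x \<subseteq> \<rat>" for x
  proof -
    have "x = (\<lambda>j. if j < d then restrict x {..<d} j else 0)" using that unfolding Rd_def by auto
    moreover have "restrict x {..<d} \<in> (\<Pi>\<^sub>E j\<in>{..<d}. (\<rat>::real set))" using that by auto
    ultimately show ?thesis unfolding E_def by (rule image_eqI)
  qed
  then have "rat_pairs d \<subseteq> E \<times> E" unfolding rat_pairs_def by auto
  then show ?thesis using cE by (meson countable_SIGMA countable_subset)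
qed

text \<open>Rational rounding that keeps zero coordinates zero and hence stays inside
  \<open>Rd d\<close>; \<open>Suc n\<close> avoids a zero denominator.\<close>

definition rnd :: "(nat \<Rightarrow> real) \<Rightarrow> nat \<Rightarrow> nat \<Rightarrow> real" where
  "rnd x n j = of_int \<lfloor>real (Suc n) * x j\<rfloor> / real (Suc n)"

lemma rnd_tendsto: "(\<lambda>n. rnd x n j) \<longlonglongrightarrow> x j"
proof -
  have inv: "(\<lambda>n. 1 / real (Suc n)) \<longlonglongrightarrow> 0" by (rule LIMSEQ_Suc[OF lim_1_over_n])
  have *: "real_of_int \<lfloor>real (Suc n) * x j\<rfloor> \<le> real (Suc n) * x j"
    "real (Suc n) * x j < real_of_int \<lfloor>real (Suc n) * x j\<rfloor> + 1" for n
    by linarith+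
  show ?thesis
  proof (rule tendsto_sandwich)
    show "\<forall>\<^sub>F n in sequentially. x j - 1 / real (Suc n) \<le> rnd x n j"
    proof (intro always_eventually allI)
      fix n
      have "x j - 1 / real (Suc n) = (real (Suc n) * x j - 1) / real (Suc n)" by (simp add: diff_divide_distrib)
      also have "\<dots> \<le> rnd x n j" unfolding rnd_def using *(2)[of n] by (intro divide_right_mono) linarith+
      finally show "x j - 1 / real (Suc n) \<le> rnd x n j" .
    qed
    show "\<forall>\<^sub>F n in sequentially. rnd x n j \<le> x j"
    proof (intro always_eventually allI)
      fix n
      have "rnd x n j \<le> (real (Suc n) * x j) / real (Suc n)" unfolding rnd_def using *(1)[of n] by (intro divide_right_mono) linarith+
      then show "rnd x n j \<le> x j" by simp
    qed
    show "(\<lambda>n. x j - 1 / real (Suc n)) \<longlonglongrightarrow> x j" using tendsto_diff[OF tendsto_const inv] by simp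
  qed simp
qed

text \<open>For fixed parameters the difference quotient is continuous at a pair of distinct points,
  so the uncountable supremum in \<open>Lip\<close> reduces to a countable one, which is measurable
  in the parameters.\<close>

lemma Lip_shallow_net_rat:
  "Lip d (shallow_net d N \<theta>) = (SUP p\<in>rat_pairs d.
    ennreal (\<bar>shallow_net d N \<theta> (fst p) - shallow_net d N \<theta> (snd p)\<bar> / dist_Rd d (fst p) (snd p)))"
  (is "_ = (SUP p\<in>_. ?r p)")
proof (rule antisym)
  show "(SUP p\<in>rat_pairs d. ?r p) \<le> Lip d (shallow_net d N \<theta>)"
    unfolding Lip_def by (rule SUP_subset_mono) (auto simp: rat_pairs_def)
  show "Lip d (shallow_net d N \<theta>) \<le> (SUP p\<in>rat_pairs d. ?r p)"
    unfolding Lip_def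
  proof (rule SUP_least, clarify)
    fix x y assume xy: "x \<in> Rd d" "y \<in> Rd d" "x \<noteq> y"
    have f: "(\<lambda>n. shallow_net d N \<theta> (rnd u n)) \<longlonglongrightarrow> shallow_net d N \<theta> u" for u
      unfolding shallow_net_def relu_def split_beta by (intro tendsto_intros rnd_tendsto)
    have dl: "(\<lambda>n. dist_Rd d (rnd x n) (rnd y n)) \<longlonglongrightarrow> dist_Rd d x y"
      unfolding dist_Rd_def by (intro tendsto_intros rnd_tendsto)
    have lim: "(\<lambda>n. ?r (rnd x n, rnd y n)) \<longlonglongrightarrow> ?r (x, y)"
      unfolding fst_conv snd_conv using dist_Rd_pos[OF xy]
      by (intro tendsto_intros f dl) auto
    show "?r (x, y) \<le> (SUP p\<in>rat_pairs d. ?r p)"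
    proof (rule tendsto_upperbound[OF lim])
      have "\<forall>\<^sub>F n in sequentially. dist_Rd d (rnd x n) (rnd y n) > 0"
        by (rule order_tendstoD(1)[OF dl dist_Rd_pos[OF xy]])
      then show "\<forall>\<^sub>F n in sequentially. ?r (rnd x n, rnd y n) \<le> (SUP p\<in>rat_pairs d. ?r p)"
      proof eventually_elim
        case (elim n)
        then have "rnd x n \<noteq> rnd y n" unfolding dist_Rd_def by auto
        then have "(rnd x n, rnd y n) \<in> rat_pairs d"
          using xy unfolding rat_pairs_def Rd_def rnd_def by auto
        then show ?case by (rule SUP_upper)
      qed
    qed simp
  qed
qed

lemma sets_param_law:
  "sets B0 = sets (PiM {..<N} (\<lambda>_. borel)) \<Longrightarrow> sets D1 = sets borel \<Longrightarrow>
   sets (param_law d N B0 D1) = sets (PiM ({..<N} \<times> {..<d}) (\<lambda>_. borel) \<Otimes>\<^sub>M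
     (PiM {..<N} (\<lambda>_. borel) \<Otimes>\<^sub>M (PiM {..<N} (\<lambda>_. borel) \<Otimes>\<^sub>M borel)))"
  unfolding param_law_def by (intro sets_pair_measure_cong sets_PiM_cong) auto

lemma Lip_measurable:
  assumes "sets B0 = sets (PiM {..<N} (\<lambda>_. borel))" "sets D1 = sets borel"
  shows "(\<lambda>\<theta>. Lip d (shallow_net d N \<theta>)) \<in> borel_measurable (param_law d N B0 D1)"
proof -
  have "(\<lambda>\<theta>. shallow_net d N \<theta> x) \<in> borel_measurable (PiM ({..<N} \<times> {..<d}) (\<lambda>_. borel) \<Otimes>\<^sub>M
     (PiM {..<N} (\<lambda>_. borel) \<Otimes>\<^sub>M (PiM {..<N} (\<lambda>_. borel) \<Otimes>\<^sub>M borel)))" for x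
    unfolding shallow_net_def relu_def split_beta by measurable
  then have [measurable]: "(\<lambda>\<theta>. shallow_net d N \<theta> x) \<in> borel_measurable (param_law d N B0 D1)" for x
    using measurable_cong_sets[OF sets_param_law[OF assms] refl] by blast
  show ?thesis unfolding Lip_shallow_net_rat
    by (intro borel_measurable_SUP countable_rat_pairs) measurable
qed

subsection \<open>Gaussian tails\<close>

abbreviation gauss :: "real \<Rightarrow> real measure" where
  "gauss \<sigma> \<equiv> density lborel (normal_density 0 \<sigma>)"

lemma nn_integral_normal_density:
  "0 < \<sigma> \<Longrightarrow> (\<integral>\<^sup>+x. ennreal (normal_density \<mu> \<sigma> x) \<partial>lborel) = 1"
  by (subst nn_integral_eq_integral) auto

lemma gauss_mgf:
  assumes "0 < \<sigma>"
  shows "(\<integral>\<^sup>+x. ennreal (exp (c * x)) \<partial>gauss \<sigma>) = ennreal (exp (c\<^sup>2 * \<sigma>\<^sup>2 / 2))"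
proof -
  have "(\<integral>\<^sup>+x. ennreal (exp (c * x)) \<partial>gauss \<sigma>)
      = (\<integral>\<^sup>+x. ennreal (normal_density 0 \<sigma> x) * ennreal (exp (c * x)) \<partial>lborel)"
    by (rule nn_integral_density) auto
  also have "\<dots> = (\<integral>\<^sup>+x. ennreal (exp (c\<^sup>2 * \<sigma>\<^sup>2 / 2)) * ennreal (normal_density (c * \<sigma>\<^sup>2) \<sigma> x) \<partial>lborel)"
  proof (rule nn_integral_cong)
    fix x
    have "-(x - 0)\<^sup>2 / (2 * \<sigma>\<^sup>2) + c * x = c\<^sup>2 * \<sigma>\<^sup>2 / 2 + - (x - c * \<sigma>\<^sup>2)\<^sup>2 / (2 * \<sigma>\<^sup>2)"
      using assms by (simp add: field_simps power2_eq_square)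
    then have "normal_density 0 \<sigma> x * exp (c * x) = exp (c\<^sup>2 * \<sigma>\<^sup>2 / 2) * normal_density (c * \<sigma>\<^sup>2) \<sigma> x"
      unfolding normal_density_def by (simp add: exp_add[symmetric] mult.left_commute)
    then show "ennreal (normal_density 0 \<sigma> x) * ennreal (exp (c * x))
        = ennreal (exp (c\<^sup>2 * \<sigma>\<^sup>2 / 2)) * ennreal (normal_density (c * \<sigma>\<^sup>2) \<sigma> x)"
      by (simp add: ennreal_mult[symmetric])
  qed
  also have "\<dots> = ennreal (exp (c\<^sup>2 * \<sigma>\<^sup>2 / 2))"
    by (subst nn_integral_cmult) (auto simp: nn_integral_normal_density[OF assms])
  finally show ?thesis .
qed

lemma gauss_exp_square: "(\<integral>\<^sup>+x. ennreal (exp (x\<^sup>2 / 8)) \<partial>gauss 1) \<le> 2"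
proof -
  \<comment> \<open>The tilt by \<open>exp (x^2 / 8)\<close> turns the standard density into
    \<open>s\<close> times a normal density with \<open>1 / s^2 = 1 - 1 / 4\<close>, so the integral
    is exactly \<open>s\<close>.\<close>
  define s :: real where "s = 2 / sqrt 3"
  have s: "s > 0" "s\<^sup>2 = 4 / 3" unfolding s_def by (auto simp: power_divide)
  have "s\<^sup>2 \<le> 2\<^sup>2" unfolding s(2) by simp
  then have s2: "s \<le> 2" by (rule power2_le_imp_le) simp
  have "(\<integral>\<^sup>+x. ennreal (exp (x\<^sup>2 / 8)) \<partial>gauss 1)
      = (\<integral>\<^sup>+x. ennreal (normal_density 0 1 x) * ennreal (exp (x\<^sup>2 / 8)) \<partial>lborel)"
    by (rule nn_integral_density) auto
  also have "\<dots> = (\<integral>\<^sup>+x. ennreal s * ennreal (normal_density 0 s x) \<partial>lborel)"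
  proof (rule nn_integral_cong)
    fix x
    have "s * (1 / sqrt (2 * pi * s\<^sup>2)) = 1 / sqrt (2 * pi)"
      using s(1) by (simp add: real_sqrt_mult)
    moreover have "- x\<^sup>2 / 2 + x\<^sup>2 / 8 = - (x - 0)\<^sup>2 / (2 * s\<^sup>2)" unfolding s(2) by (simp add: field_simps)
    moreover have "normal_density 0 1 x * exp (x\<^sup>2 / 8) = 1 / sqrt (2 * pi) * exp (- x\<^sup>2 / 2 + x\<^sup>2 / 8)"
      unfolding std_normal_density_def exp_add by (rule mult.assoc)
    ultimately have "normal_density 0 1 x * exp (x\<^sup>2 / 8)
        = s * (1 / sqrt (2 * pi * s\<^sup>2)) * exp (- (x - 0)\<^sup>2 / (2 * s\<^sup>2))"
      by simp
    also have "\<dots> = s * normal_density 0 s x" unfolding normal_density_def by (rule mult.assoc)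
    finally have "normal_density 0 1 x * exp (x\<^sup>2 / 8) = s * normal_density 0 s x" .
    then show "ennreal (normal_density 0 1 x) * ennreal (exp (x\<^sup>2 / 8)) = ennreal s * ennreal (normal_density 0 s x)"
      using s(1) by (simp add: ennreal_mult[symmetric])
  qed
  also have "\<dots> = ennreal s"
    using s(1) by (subst nn_integral_cmult) (auto simp: nn_integral_normal_density)
  also have "\<dots> \<le> ennreal 2" using s2 by (rule ennreal_leI)
  finally show ?thesis by simp
qed

lemma product_sigma_finite_gauss: "0 < \<sigma> \<Longrightarrow> product_sigma_finite (\<lambda>_. gauss \<sigma>)"
  unfolding product_sigma_finite_def
  by (auto intro: prob_space_imp_sigma_finite prob_space_normal_density)

lemma prob_space_PiM_gauss: "0 < \<sigma> \<Longrightarrow> prob_space (PiM I (\<lambda>_. gauss \<sigma>))"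
  by (intro prob_space_PiM prob_space_normal_density)

lemma PiM_gauss_mgf:
  assumes "finite I" "0 < \<sigma>"
  shows "(\<integral>\<^sup>+x. ennreal (exp (\<Sum>i\<in>I. c i * x i)) \<partial>PiM I (\<lambda>_. gauss \<sigma>))
    = ennreal (exp (\<sigma>\<^sup>2 / 2 * (\<Sum>i\<in>I. (c i)\<^sup>2)))"
proof -
  interpret product_sigma_finite "\<lambda>_. gauss \<sigma>" by (rule product_sigma_finite_gauss) fact
  have "(\<integral>\<^sup>+x. ennreal (exp (\<Sum>i\<in>I. c i * x i)) \<partial>PiM I (\<lambda>_. gauss \<sigma>))
      = (\<integral>\<^sup>+x. (\<Prod>i\<in>I. ennreal (exp (c i * x i))) \<partial>PiM I (\<lambda>_. gauss \<sigma>))"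
    by (simp add: exp_sum[OF assms(1)] prod_ennreal)
  also have "\<dots> = (\<Prod>i\<in>I. \<integral>\<^sup>+x. ennreal (exp (c i * x)) \<partial>gauss \<sigma>)"
    by (rule product_nn_integral_prod[OF assms(1)]) auto
  also have "\<dots> = (\<Prod>i\<in>I. ennreal (exp ((c i)\<^sup>2 * \<sigma>\<^sup>2 / 2)))" by (simp add: gauss_mgf assms)
  also have "\<dots> = ennreal (exp (\<sigma>\<^sup>2 / 2 * (\<Sum>i\<in>I. (c i)\<^sup>2)))"
    by (simp add: prod_ennreal exp_sum[OF assms(1), symmetric] sum_distrib_left mult_ac)
  finally show ?thesis .
qed

lemma exp_markov:
  assumes [measurable]: "f \<in> borel_measurable M"
    and le: "(\<integral>\<^sup>+x. ennreal (exp (f x)) \<partial>M) \<le> ennreal (exp a)"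
  shows "emeasure M {x \<in> space M. t < f x} \<le> ennreal (exp (a - t))"
proof -
  have "emeasure M {x \<in> space M. t < f x}
      \<le> emeasure M {x \<in> space M. 1 \<le> ennreal (exp (- t)) * ennreal (exp (f x))}"
  proof (rule emeasure_mono)
    show "{x \<in> space M. t < f x} \<subseteq> {x \<in> space M. 1 \<le> ennreal (exp (- t)) * ennreal (exp (f x))}"
      by (auto simp: ennreal_mult[symmetric] exp_add[symmetric] one_le_exp_iff ennreal_1[symmetric] simp del: ennreal_1)
  qed measurable
  also have "\<dots> \<le> ennreal (exp (- t)) * (\<integral>\<^sup>+x. ennreal (exp (f x)) * indicator (space M) x \<partial>M)"
    by (rule nn_integral_Markov_inequality) auto
  also have "\<dots> = ennreal (exp (- t)) * (\<integral>\<^sup>+x. ennreal (exp (f x)) \<partial>M)"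
    by (intro arg_cong[where f="\<lambda>z. _ * z"] nn_integral_cong) auto
  also have "\<dots> \<le> ennreal (exp (- t)) * ennreal (exp a)" by (intro mult_left_mono le) auto
  also have "\<dots> = ennreal (exp (a - t))" by (simp add: ennreal_mult[symmetric] exp_add[symmetric])
  finally show ?thesis .
qed

lemma gauss_linear_tail:
  fixes N :: nat
  assumes V: "(\<Sum>i<N. (c i)\<^sup>2) \<le> V" "0 < V" "0 < t"
  shows "emeasure (PiM {..<N} (\<lambda>_. gauss 1)) {a \<in> space (PiM {..<N} (\<lambda>_. gauss 1)). t < (\<Sum>i<N. a i * c i)}
    \<le> ennreal (exp (- t\<^sup>2 / (2 * V)))"
proof -
  let ?M = "PiM {..<N} (\<lambda>_. gauss 1)"
  \<comment> \<open>The minimiser of the Chernoff exponent \<open>l^2 V / 2 - l t\<close>.\<close>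
  define l where "l = t / V"
  have l: "l > 0" using assms unfolding l_def by simp
  have "(\<integral>\<^sup>+a. ennreal (exp (\<Sum>i<N. l * c i * a i)) \<partial>?M)
      = ennreal (exp (1\<^sup>2 / 2 * (\<Sum>i<N. (l * c i)\<^sup>2)))"
    by (rule PiM_gauss_mgf) auto
  also have "\<dots> \<le> ennreal (exp (l\<^sup>2 * V / 2))"
    using V(1) by (intro ennreal_leI) (simp add: power_mult_distrib sum_distrib_left[symmetric] mult_left_mono)
  finally have "emeasure ?M {a \<in> space ?M. l * t < (\<Sum>i<N. l * c i * a i)} \<le> ennreal (exp (l\<^sup>2 * V / 2 - l * t))"
    by (intro exp_markov) measurable
  also have "{a \<in> space ?M. l * t < (\<Sum>i<N. l * c i * a i)} = {a \<in> space ?M. t < (\<Sum>i<N. a i * c i)}"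
  proof -
    have "(\<Sum>i<N. l * c i * a i) = l * (\<Sum>i<N. a i * c i)" for a
      by (simp add: sum_distrib_left mult_ac)
    then show ?thesis using l by simp
  qed
  also have "l\<^sup>2 * V / 2 - l * t = - t\<^sup>2 / (2 * V)"
    unfolding l_def using V by (simp add: field_simps power2_eq_square)
  finally show ?thesis .
qed

lemma two_power_le_exp: "(2::real) ^ n \<le> exp (real n)"
proof -
  have "(2::real) ^ n \<le> exp 1 ^ n" using exp_ge_add_one_self[of 1] by (intro power_mono) auto
  then show ?thesis by (simp add: exp_of_nat_mult[symmetric])
qed

lemma gauss_square_sum_tail:
  "emeasure (PiM {..<N} (\<lambda>_. gauss 1)) {a \<in> space (PiM {..<N} (\<lambda>_. gauss 1)). s < (\<Sum>i<N. (a i)\<^sup>2)}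
    \<le> ennreal (exp (real N - s / 8))"
proof -
  let ?M = "PiM {..<N} (\<lambda>_. gauss 1)"
  interpret product_sigma_finite "\<lambda>_::nat. gauss 1" by (rule product_sigma_finite_gauss) simp
  have "(\<integral>\<^sup>+a. ennreal (exp (\<Sum>i<N. (a i)\<^sup>2 / 8)) \<partial>?M) = (\<integral>\<^sup>+a. (\<Prod>i<N. ennreal (exp ((a i)\<^sup>2 / 8))) \<partial>?M)"
    by (simp add: exp_sum prod_ennreal)
  also have "\<dots> = (\<Prod>i<N. \<integral>\<^sup>+x. ennreal (exp (x\<^sup>2 / 8)) \<partial>gauss 1)"
    by (rule product_nn_integral_prod) auto
  also have "\<dots> \<le> (\<Prod>i<N. 2)" by (intro prod_mono_ennreal gauss_exp_square)
  also have "\<dots> = ennreal (2 ^ N)" by (simp add: ennreal_power[symmetric])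
  also have "\<dots> \<le> ennreal (exp (real N))" by (intro ennreal_leI two_power_le_exp)
  finally have "emeasure ?M {a \<in> space ?M. s / 8 < (\<Sum>i<N. (a i)\<^sup>2 / 8)} \<le> ennreal (exp (real N - s / 8))"
    by (intro exp_markov) measurable
  then show ?thesis by (simp add: sum_divide_distrib[symmetric] divide_less_cancel)
qed

section \<open>First-layer rows and their excess mass\<close>

text \<open>Dividing by the standard deviation of the entries gives, for \<open>v\<close> in the
  unit ball, centred Gaussians of variance at most 1, so the estimates below do not depend on the
  scaling of the layer.\<close>

definition row_form :: "nat \<Rightarrow> real \<Rightarrow> (nat \<Rightarrow> real) \<Rightarrow> (nat \<times> nat \<Rightarrow> real) \<Rightarrow> nat \<Rightarrow> real" where
  "row_form d \<sigma> v W i = (\<Sum>j<d. W (i, j) * v j) / \<sigma>"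

lemma measurable_row_form [measurable]:
  "i < N \<Longrightarrow> (\<lambda>W. row_form d \<sigma> v W i) \<in> borel_measurable (PiM ({..<N} \<times> {..<d}) (\<lambda>_. gauss \<tau>))"
  unfolding row_form_def by measurable

text \<open>Writing \<open>exp (h\<^sup>2 / 8)\<close> as the Gaussian average of \<open>exp (z h / 2)\<close> over \<open>z\<close> avoids computing the
  law of a linear combination of Gaussians.\<close>

lemma row_form_exp_square:
  assumes \<sigma>: "0 < \<sigma>" and v: "(\<Sum>j<d. (v j)\<^sup>2) \<le> 1" and i: "i < N"
  shows "(\<integral>\<^sup>+W. ennreal (exp ((row_form d \<sigma> v W i)\<^sup>2 / 8)) \<partial>PiM ({..<N} \<times> {..<d}) (\<lambda>_. gauss \<sigma>)) \<le> 2"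
proof -
  let ?P = "PiM ({..<N} \<times> {..<d}) (\<lambda>_. gauss \<sigma>)"
  interpret P: prob_space ?P by (rule prob_space_PiM_gauss) fact
  interpret G: prob_space "gauss 1" by (rule prob_space_normal_density) simp
  interpret PG: pair_sigma_finite ?P "gauss 1" ..
  note [measurable] = measurable_row_form[OF i]
  define c where "c z p = (if fst p = i then v (snd p) * z / (2 * \<sigma>) else 0)" for z and p :: "nat \<times> nat"
  have rf: "(row_form d \<sigma> v W i / 2) * z = (\<Sum>p\<in>{..<N} \<times> {..<d}. c z p * W p)" for W z
  proof -
    have "(\<Sum>p\<in>{..<N} \<times> {..<d}. c z p * W p) = (\<Sum>i'<N. \<Sum>j<d. c z (i', j) * W (i', j))"
      by (simp add: sum.cartesian_product)
    also have "\<dots> = (\<Sum>i'<N. if i' = i then (\<Sum>j<d. v j * z / (2 * \<sigma>) * W (i, j)) else 0)"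
      unfolding c_def by (intro sum.cong) auto
    also have "\<dots> = (\<Sum>j<d. v j * z / (2 * \<sigma>) * W (i, j))" using i by simp
    also have "\<dots> = (row_form d \<sigma> v W i / 2) * z"
      unfolding row_form_def sum_divide_distrib sum_distrib_right by (intro sum.cong) (auto simp: mult_ac)
    finally show ?thesis by simp
  qed
  have c2: "(\<Sum>p\<in>{..<N} \<times> {..<d}. (c z p)\<^sup>2) = z\<^sup>2 / (4 * \<sigma>\<^sup>2) * (\<Sum>j<d. (v j)\<^sup>2)" for z
  proof -
    have "(\<Sum>p\<in>{..<N} \<times> {..<d}. (c z p)\<^sup>2) = (\<Sum>i'<N. \<Sum>j<d. (c z (i', j))\<^sup>2)"
      by (simp add: sum.cartesian_product)
    also have "\<dots> = (\<Sum>i'<N. if i' = i then (\<Sum>j<d. (v j * z / (2 * \<sigma>))\<^sup>2) else 0)"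
      unfolding c_def by (intro sum.cong) auto
    also have "\<dots> = (\<Sum>j<d. (v j * z / (2 * \<sigma>))\<^sup>2)" using i by simp
    also have "\<dots> = z\<^sup>2 / (4 * \<sigma>\<^sup>2) * (\<Sum>j<d. (v j)\<^sup>2)"
      unfolding sum_distrib_left by (intro sum.cong) (auto simp: power_mult_distrib power_divide)
    finally show ?thesis .
  qed
  have "(\<integral>\<^sup>+W. ennreal (exp ((row_form d \<sigma> v W i)\<^sup>2 / 8)) \<partial>?P)
      = (\<integral>\<^sup>+W. \<integral>\<^sup>+z. ennreal (exp ((row_form d \<sigma> v W i / 2) * z)) \<partial>gauss 1 \<partial>?P)"
    by (subst gauss_mgf) (auto simp: power_divide)
  also have "\<dots> = (\<integral>\<^sup>+z. \<integral>\<^sup>+W. ennreal (exp ((row_form d \<sigma> v W i / 2) * z)) \<partial>?P \<partial>gauss 1)"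
    by (rule PG.Fubini'[symmetric]) measurable
  also have "\<dots> = (\<integral>\<^sup>+z. ennreal (exp (\<sigma>\<^sup>2 / 2 * (\<Sum>p\<in>{..<N} \<times> {..<d}. (c z p)\<^sup>2))) \<partial>gauss 1)"
    unfolding rf by (subst PiM_gauss_mgf) (auto simp: \<sigma>)
  also have "\<dots> \<le> (\<integral>\<^sup>+z. ennreal (exp (z\<^sup>2 / 8)) \<partial>gauss 1)"
  proof (intro nn_integral_mono ennreal_leI)
    fix z :: real
    have "\<sigma>\<^sup>2 / 2 * (z\<^sup>2 / (4 * \<sigma>\<^sup>2) * (\<Sum>j<d. (v j)\<^sup>2)) = z\<^sup>2 / 8 * (\<Sum>j<d. (v j)\<^sup>2)" using \<sigma> by simp
    also have "\<dots> \<le> z\<^sup>2 / 8 * 1" using v by (intro mult_left_mono) auto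
    finally show "exp (\<sigma>\<^sup>2 / 2 * (\<Sum>p\<in>{..<N} \<times> {..<d}. (c z p)\<^sup>2)) \<le> exp (z\<^sup>2 / 8)"
      unfolding c2 by simp
  qed
  also have "\<dots> \<le> 2" by (rule gauss_exp_square)
  finally show ?thesis .
qed

lemma indep_vars_PiM_coordinates:
  assumes M: "\<And>i. prob_space (M i)"
  shows "prob_space.indep_vars (PiM I M) M (\<lambda>i x. x i) I"
proof -
  interpret P: prob_space "PiM I M" by (rule prob_space_PiM[OF M])
  show ?thesis
  proof (cases "I = {}")
    case True
    show ?thesis unfolding P.indep_vars_def P.indep_sets_def using True by simp
  next
    case False
    show ?thesis
    proof (subst P.indep_vars_iff_distr_eq_PiM'[OF False])
      have "distr (PiM I M) (PiM I M) (\<lambda>x. restrict (\<lambda>i. x i) I) = distr (PiM I M) (PiM I M) (\<lambda>x. x)"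
        by (rule distr_cong) (auto simp: space_PiM)
      also have "\<dots> = PiM I M" by (rule distr_id2) simp
      also have "\<dots> = PiM I (\<lambda>i. distr (PiM I M) (M i) (\<lambda>x. x i))"
        by (intro PiM_cong refl distr_PiM_component[symmetric] M)
      finally show "distr (PiM I M) (PiM I M) (\<lambda>x. restrict (\<lambda>i. x i) I)
        = PiM I (\<lambda>i. distr (PiM I M) (M i) (\<lambda>x. x i))" .
    qed (rule measurable_component_singleton)
  qed
qed

text \<open>The form of row \<open>i\<close> reads only the block
  \<open>{i} \<times> {..<d}\<close>; the blocks are disjoint, so exponential moments factorise over
  the rows.\<close>

lemma row_form_independent:
  assumes \<sigma>: "0 < \<sigma>" and F [measurable]: "F \<in> borel_measurable borel"
  shows "(\<integral>\<^sup>+W. (\<Prod>i<N. (F (row_form d \<sigma> v W i) :: ennreal)) \<partial>PiM ({..<N} \<times> {..<d}) (\<lambda>_. gauss \<sigma>))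
    = (\<Prod>i<N. \<integral>\<^sup>+W. F (row_form d \<sigma> v W i) \<partial>PiM ({..<N} \<times> {..<d}) (\<lambda>_. gauss \<sigma>))"
proof -
  let ?I = "{..<N} \<times> {..<d}"
  let ?P = "PiM ?I (\<lambda>_. gauss \<sigma>)"
  interpret P: prob_space ?P by (rule prob_space_PiM_gauss) fact
  have "P.indep_vars (\<lambda>_. gauss \<sigma>) (\<lambda>p W. W p) ?I"
    by (rule indep_vars_PiM_coordinates) (intro prob_space_normal_density \<sigma>)
  then have "P.indep_vars (\<lambda>i. PiM ({i} \<times> {..<d}) (\<lambda>_. gauss \<sigma>)) (\<lambda>i W. restrict (\<lambda>p. W p) ({i} \<times> {..<d})) {..<N}"
    by (rule P.indep_vars_restrict) (auto simp: disjoint_family_on_def)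
  then have "P.indep_vars (\<lambda>_. borel) (\<lambda>i W. F (row_form d \<sigma> v (restrict (\<lambda>p. W p) ({i} \<times> {..<d})) i)) {..<N}"
  proof (rule P.indep_vars_compose2)
    fix i assume "i \<in> {..<N}"
    have "(\<lambda>W. row_form d \<sigma> v W i) \<in> borel_measurable (PiM ({i} \<times> {..<d}) (\<lambda>_. gauss \<sigma>))"
      unfolding row_form_def by measurable
    then show "(\<lambda>W. F (row_form d \<sigma> v W i)) \<in> borel_measurable (PiM ({i} \<times> {..<d}) (\<lambda>_. gauss \<sigma>))"
      by measurable
  qed
  moreover have "row_form d \<sigma> v (restrict (\<lambda>p. W p) ({i} \<times> {..<d})) i = row_form d \<sigma> v W i" for W i
    unfolding row_form_def by simp
  ultimately have "P.indep_vars (\<lambda>_. borel) (\<lambda>i W. F (row_form d \<sigma> v W i)) {..<N}" by simp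
  then show ?thesis by (intro P.indep_vars_nn_integral) auto
qed

text \<open>The part of the squared row values above a cut-off. It serves all sets of rows at once:
  the mass on any \<open>I\<close> is at most \<open>card I * \<tau>\<close> plus this quantity
  (\<open>sum_square_le_excess\<close>), which spares a union bound over \<open>I\<close>. With
  \<open>\<tau> = 0\<close> it is the full sum of squares.\<close>

definition excess :: "nat \<Rightarrow> nat \<Rightarrow> real \<Rightarrow> real \<Rightarrow> (nat \<Rightarrow> real) \<Rightarrow> (nat \<times> nat \<Rightarrow> real) \<Rightarrow> real" where
  "excess d N \<sigma> \<tau> v W = (\<Sum>i<N. max 0 ((row_form d \<sigma> v W i)\<^sup>2 - \<tau>))"

lemma measurable_excess [measurable]:
  "excess d N \<sigma> \<tau> v \<in> borel_measurable (PiM ({..<N} \<times> {..<d}) (\<lambda>_. gauss \<sigma>'))"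
  unfolding excess_def by (intro borel_measurable_sum) measurable

text \<open>Chernoff with parameter \<open>1 / 8\<close>. Per row, \<open>exp (max 0 (h^2 - \<tau>)
  / 8) <= 1 + exp (- \<tau> / 8) * exp (h^2 / 8)\<close>, whose mean is at most
  \<open>1 + 2 exp (- \<tau> / 8)\<close>. A high cut-off thus makes the moment of a row close to 1,
  and the \<open>N\<close> rows multiply.\<close>

lemma excess_tail:
  assumes \<sigma>: "0 < \<sigma>" and v: "(\<Sum>j<d. (v j)\<^sup>2) \<le> 1"
  shows "emeasure (PiM ({..<N} \<times> {..<d}) (\<lambda>_. gauss \<sigma>))
      {W \<in> space (PiM ({..<N} \<times> {..<d}) (\<lambda>_. gauss \<sigma>)). s < excess d N \<sigma> \<tau> v W}
    \<le> ennreal (exp (2 * real N * exp (- \<tau> / 8) - s / 8))"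
proof -
  let ?P = "PiM ({..<N} \<times> {..<d}) (\<lambda>_. gauss \<sigma>)"
  interpret P: prob_space ?P by (rule prob_space_PiM_gauss) fact
  define F where "F h = ennreal (exp (max 0 (h\<^sup>2 - \<tau>) / 8))" for h :: real
  have [measurable]: "F \<in> borel_measurable borel" unfolding F_def by measurable
  have row: "(\<integral>\<^sup>+W. F (row_form d \<sigma> v W i) \<partial>?P) \<le> ennreal (exp (2 * exp (- \<tau> / 8)))" if i: "i < N" for i
  proof -
    note [measurable] = measurable_row_form[OF i]
    have "F h \<le> 1 + ennreal (exp (- \<tau> / 8)) * ennreal (exp (h\<^sup>2 / 8))" for h
    proof -
      have "exp (max 0 (h\<^sup>2 - \<tau>) / 8) \<le> 1 + exp ((h\<^sup>2 - \<tau>) / 8)"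
        by (auto simp: max_def add_increasing add_increasing2)
      also have "exp ((h\<^sup>2 - \<tau>) / 8) = exp (- \<tau> / 8) * exp (h\<^sup>2 / 8)"
        by (simp add: exp_add[symmetric] diff_divide_distrib)
      finally show ?thesis unfolding F_def
        by (simp add: ennreal_mult[symmetric] ennreal_1[symmetric] ennreal_plus[symmetric] ennreal_leI del: ennreal_1 ennreal_plus)
    qed
    then have "(\<integral>\<^sup>+W. F (row_form d \<sigma> v W i) \<partial>?P)
        \<le> (\<integral>\<^sup>+W. 1 + ennreal (exp (- \<tau> / 8)) * ennreal (exp ((row_form d \<sigma> v W i)\<^sup>2 / 8)) \<partial>?P)"
      by (intro nn_integral_mono)
    also have "\<dots> = 1 + ennreal (exp (- \<tau> / 8)) * (\<integral>\<^sup>+W. ennreal (exp ((row_form d \<sigma> v W i)\<^sup>2 / 8)) \<partial>?P)"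
      by (subst nn_integral_add) (auto simp: nn_integral_cmult P.emeasure_space_1)
    also have "\<dots> \<le> 1 + ennreal (exp (- \<tau> / 8)) * 2"
      by (intro add_left_mono mult_left_mono row_form_exp_square \<sigma> v i) auto
    also have "\<dots> = ennreal (1 + 2 * exp (- \<tau> / 8))"
      by (simp add: ennreal_mult mult.commute)
    also have "\<dots> \<le> ennreal (exp (2 * exp (- \<tau> / 8)))" by (intro ennreal_leI exp_ge_add_one_self)
    finally show ?thesis .
  qed
  have "(\<integral>\<^sup>+W. ennreal (exp (excess d N \<sigma> \<tau> v W / 8)) \<partial>?P) = (\<integral>\<^sup>+W. (\<Prod>i<N. F (row_form d \<sigma> v W i)) \<partial>?P)"
    unfolding excess_def F_def by (simp add: sum_divide_distrib exp_sum prod_ennreal)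
  also have "\<dots> = (\<Prod>i<N. \<integral>\<^sup>+W. F (row_form d \<sigma> v W i) \<partial>?P)"
    by (rule row_form_independent[OF \<sigma>]) measurable
  also have "\<dots> \<le> (\<Prod>i<N. ennreal (exp (2 * exp (- \<tau> / 8))))"
    by (intro prod_mono_ennreal row) auto
  also have "\<dots> = ennreal (exp (2 * real N * exp (- \<tau> / 8)))"
    by (simp add: ennreal_power exp_of_nat_mult[symmetric] mult_ac)
  finally have "emeasure ?P {W \<in> space ?P. s / 8 < excess d N \<sigma> \<tau> v W / 8}
      \<le> ennreal (exp (2 * real N * exp (- \<tau> / 8) - s / 8))"
    by (intro exp_markov) measurable
  then show ?thesis by (simp add: divide_less_cancel)
qed

text \<open>Only \<open>E\<close> and \<open>G\<close> have to be measurable on the respective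
  spaces. Outside \<open>G\<close> each section in the middle variable is bounded separately, so the
  exceptional set of the second layer may depend on the first layer and the biases in any
  manner.\<close>

lemma emeasure_triple_section_bound:
  assumes "prob_space A" "prob_space B" "prob_space Q"
    and E: "E \<in> sets (A \<Otimes>\<^sub>M (B \<Otimes>\<^sub>M Q))" and G: "G \<in> sets A"
    and G_small: "emeasure A G \<le> \<delta>"
    and sec: "\<And>w q. w \<in> space A \<Longrightarrow> w \<notin> G \<Longrightarrow> q \<in> space Q \<Longrightarrow> emeasure B {a \<in> space B. (w, a, q) \<in> E} \<le> \<delta>'"
  shows "emeasure (A \<Otimes>\<^sub>M (B \<Otimes>\<^sub>M Q)) E \<le> \<delta> + \<delta>'"
proof -
  interpret A: prob_space A by fact
  interpret B: prob_space B by fact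
  interpret Q: prob_space Q by fact
  interpret BQ: pair_sigma_finite B Q ..
  have BQ_prob: "prob_space (B \<Otimes>\<^sub>M Q)" by (rule prob_space_pair) fact+
  have E': "Pair w -` E \<in> sets (B \<Otimes>\<^sub>M Q)" for w by (rule sets_Pair1[OF E])
  have good: "emeasure (B \<Otimes>\<^sub>M Q) (Pair w -` E) \<le> \<delta>'" if w: "w \<in> space A" "w \<notin> G" for w
  proof -
    have "emeasure (B \<Otimes>\<^sub>M Q) (Pair w -` E) = (\<integral>\<^sup>+q. emeasure B ((\<lambda>a. (a, q)) -` (Pair w -` E)) \<partial>Q)"
      by (rule BQ.emeasure_pair_measure_alt2[OF E'])
    also have "\<dots> \<le> (\<integral>\<^sup>+q. \<delta>' \<partial>Q)"
    proof (rule nn_integral_mono)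
      fix q assume q: "q \<in> space Q"
      have "(\<lambda>a. (a, q)) -` (Pair w -` E) = {a \<in> space B. (w, a, q) \<in> E}"
        using sets.sets_into_space[OF E'[of w]] by (auto simp: space_pair_measure)
      then show "emeasure B ((\<lambda>a. (a, q)) -` (Pair w -` E)) \<le> \<delta>'" using sec[OF w q] by simp
    qed
    also have "\<dots> = \<delta>'" by (simp add: Q.emeasure_space_1)
    finally show ?thesis .
  qed
  have "emeasure (A \<Otimes>\<^sub>M (B \<Otimes>\<^sub>M Q)) E = (\<integral>\<^sup>+w. emeasure (B \<Otimes>\<^sub>M Q) (Pair w -` E) \<partial>A)"
    by (rule sigma_finite_measure.emeasure_pair_measure_alt[OF prob_space_imp_sigma_finite[OF BQ_prob] E])
  also have "\<dots> \<le> (\<integral>\<^sup>+w. indicator G w + \<delta>' \<partial>A)"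
  proof (rule nn_integral_mono)
    fix w assume w: "w \<in> space A"
    show "emeasure (B \<Otimes>\<^sub>M Q) (Pair w -` E) \<le> indicator G w + \<delta>'"
    proof (cases "w \<in> G")
      case True
      have "emeasure (B \<Otimes>\<^sub>M Q) (Pair w -` E) \<le> 1" by (rule prob_space.emeasure_le_1[OF BQ_prob])
      also have "\<dots> \<le> indicator G w + \<delta>'" using True by simp
      finally show ?thesis .
    qed (use good[OF w] in simp)
  qed
  also have "\<dots> = emeasure A G + \<delta>'" using G by (subst nn_integral_add) (auto simp: A.emeasure_space_1)
  also have "\<dots> \<le> \<delta> + \<delta>'" using G_small by (rule add_right_mono)
  finally show ?thesis .
qed

subsection \<open>Chaining\<close>

text \<open>Of the exponent \<open>2 x (k + 1)\<close> one \<open>x\<close> is kept, and the rest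
  \<open>x (2 k + 1) >= k + 1\<close> pays for the geometric weight of level
  \<open>k\<close>.\<close>

lemma sum_exp_levels:
  assumes "1 \<le> (x::real)"
  shows "(\<Sum>k\<le>K. exp (- (2 * x * (real k + 1)))) \<le> exp (- x)"
proof -
  have "(\<Sum>k\<le>K. exp (- (2 * x * (real k + 1)))) \<le> (\<Sum>k\<le>K. exp (- x) * (1/2) ^ Suc k)"
  proof (rule sum_mono)
    fix k
    have "real k + 1 \<le> x * (2 * real k + 1)"
    proof -
      have "real k + 1 \<le> 1 * (2 * real k + 1)" by simp
      also have "\<dots> \<le> x * (2 * real k + 1)" using assms by (intro mult_right_mono) auto
      finally show ?thesis .
    qed
    then have "exp (- (2 * x * (real k + 1))) \<le> exp (- x + - real (Suc k))"
      by (simp add: algebra_simps)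
    also have "\<dots> = exp (- x) * exp (- real (Suc k))" by (rule exp_add)
    also have "exp (- real (Suc k)) \<le> (1/2) ^ Suc k"
      unfolding power_one_over exp_minus inverse_eq_divide
      using two_power_le_exp[of "Suc k"] by (intro divide_left_mono) auto
    finally show "exp (- (2 * x * (real k + 1))) \<le> exp (- x) * (1/2) ^ Suc k" by simp
  qed
  also have "\<dots> = exp (- x) * (\<Sum>k\<le>K. (1/2) ^ Suc k)" by (simp add: sum_distrib_left)
  also have "(\<Sum>k\<le>K. (1/2::real) ^ Suc k) = 1 - (1/2) ^ Suc K" by (induction K) auto
  also have "exp (- x) * \<dots> \<le> exp (- x) * 1" by (intro mult_left_mono) auto
  finally show ?thesis by simp
qed

lemma Suc_le_power_real: assumes "2 \<le> (b::real)" shows "real k + 1 \<le> b ^ k"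
proof -
  have "real k + 1 \<le> 2 ^ k" using less_exp[of k] by (metis Suc_leI add.commute of_nat_Suc of_nat_le_iff of_nat_numeral of_nat_power)
  also have "\<dots> \<le> b ^ k" using assms by (intro power_mono) auto
  finally show ?thesis .
qed

section \<open>Approximating families of patterns\<close>

lemma card_patterns:
  assumes "1 \<le> d" "d \<le> N"
  shows "real (card (range (active d N W b))) \<le> exp (real d) * (real N / real d) ^ (d + 1)"
proof -
  \<comment> \<open>The weight \<open>d / N\<close> in the Sauer bound makes the exponential factor
    exactly \<open>exp d\<close>.\<close>
  have "real (card (range (active d N W b))) \<le> exp (real d / real N * card {..<N}) / (real d / real N) ^ (d + 1)"
  proof (rule sauer_exp)
    show "range (active d N W b) \<subseteq> Pow {..<N}" using active_subset by blast
  qed (use assms active_vc in auto)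
  also have "\<dots> = exp (real d) * (real N / real d) ^ (d + 1)"
    using assms by (simp add: power_divide)
  finally show ?thesis .
qed

text \<open>The intermediate levels are nets from \<open>exists_net\<close> with VC bound
  \<open>d + 1\<close>, and \<open>2 (d + 1) <= 4 d\<close>. The two ends are special: level 0 is
  the empty pattern, whose error is at most \<open>N\<close>, and level \<open>Suc K\<close>
  consists of all patterns, with error 0. The full family obeys the same cardinality bound because
  \<open>N / d < 64 ^ Suc K\<close>.\<close>

lemma chain_families:
  assumes d: "1 \<le> d" and K: "d * 64 ^ K \<le> N" "N < d * 64 ^ Suc K"
  obtains T :: "nat \<Rightarrow> nat set set" and \<pi> where
    "\<And>k. k \<le> Suc K \<Longrightarrow> finite (T k)"
    "\<And>k. k \<le> Suc K \<Longrightarrow> real (card (T k)) \<le> (8 * 64 ^ k) ^ (4 * d)"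
    "\<And>k x. k \<le> Suc K \<Longrightarrow> \<pi> k (active d N W b x) \<in> T k"
    "\<And>k x. k \<le> Suc K \<Longrightarrow> \<pi> k (active d N W b x) \<subseteq> {..<N}"
    "\<And>k x. k \<le> Suc K \<Longrightarrow> card (sym_diff (active d N W b x) (\<pi> k (active d N W b x))) \<le> real N / 64 ^ k"
    "\<And>x. \<pi> (Suc K) (active d N W b x) = active d N W b x"
    "\<And>x. \<pi> 0 (active d N W b x) = {}"
proof -
  define F where "F = range (active d N W b)"
  have F: "F \<subseteq> Pow {..<N}" unfolding F_def using active_subset by blast
  have "d * 1 \<le> d * 64 ^ K" by (intro mult_left_mono) auto
  then have dN: "d \<le> N" using K by linarith
  have vc: "card B \<le> d + 1" if "shatters F B" "finite B" for B
    using that active_vc unfolding F_def by blast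
  have "\<exists>T\<subseteq>F. real (card T) \<le> (8 / (1 / 64 ^ k)) ^ (2 * (d + 1)) \<and>
      (\<forall>A\<in>F. \<exists>B\<in>T. card (sym_diff A B) \<le> 1 / 64 ^ k * real N)" for k
    by (rule exists_net[OF F]) (use dN d vc in auto)
  then obtain U where U: "\<And>k. U k \<subseteq> F" "\<And>k. real (card (U k)) \<le> (8 / (1 / 64 ^ k)) ^ (2 * (d + 1))"
    "\<And>k A. A \<in> F \<Longrightarrow> \<exists>B\<in>U k. card (sym_diff A B) \<le> 1 / 64 ^ k * real N"
    by metis
  define \<rho> where "\<rho> k A = (SOME B. B \<in> U k \<and> card (sym_diff A B) \<le> 1 / 64 ^ k * real N)" for k A
  have "\<rho> k A \<in> U k \<and> card (sym_diff A (\<rho> k A)) \<le> 1 / 64 ^ k * real N" if "A \<in> F" for k A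
    unfolding \<rho>_def by (rule someI_ex) (use U(3)[OF that] in blast)
  then have \<rho>: "\<And>k A. A \<in> F \<Longrightarrow> \<rho> k A \<in> U k"
    "\<And>k A. A \<in> F \<Longrightarrow> card (sym_diff A (\<rho> k A)) \<le> 1 / 64 ^ k * real N"
    by blast+
  define T where "T k = (if k = 0 then {{}} else if k \<le> K then U k else F)" for k
  define \<pi> where "\<pi> k A = (if k = 0 then {} else if k \<le> K then \<rho> k A else A)" for k A
  have AF: "active d N W b x \<in> F" for x unfolding F_def by simp
  have finF: "finite F" by (rule finite_subset[OF F]) simp
  show ?thesis
  proof (rule that[of T \<pi>])
    fix k assume k: "k \<le> Suc K"
    show "finite (T k)" unfolding T_def using finite_subset[OF U(1) finF] finF by auto
    show "real (card (T k)) \<le> (8 * 64 ^ k) ^ (4 * d)"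
    proof -
      consider "k = 0" | "k \<noteq> 0" "k \<le> K" | "k = Suc K" using k by linarith
      then show ?thesis
      proof cases
        case 1
        then show ?thesis unfolding T_def by simp
      next
        case 2
        have "real (card (U k)) \<le> (8 * 64 ^ k) ^ (2 * (d + 1))" using U(2)[of k] by simp
        also have "\<dots> \<le> (8 * 64 ^ k) ^ (4 * d)"
        proof (rule power_increasing)
          show "1 \<le> 8 * (64::real) ^ k" using one_le_power[of "64::real" k] by linarith
        qed (use d in auto)
        finally show ?thesis unfolding T_def using 2 by simp
      next
        case 3
        have "real (card F) \<le> exp (real d) * (real N / real d) ^ (d + 1)"
          unfolding F_def by (rule card_patterns[OF d dN])
        also have "\<dots> \<le> 8 ^ (4 * d) * (64 ^ Suc K) ^ (4 * d)"
        proof (intro mult_mono)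
          have "exp (real d) = exp 1 ^ d" by (simp add: exp_of_nat_mult[symmetric])
          also have "\<dots> \<le> 8 ^ d" using exp_le by (intro power_mono) auto
          also have "\<dots> \<le> (8::real) ^ (4 * d)" by (intro power_increasing) auto
          finally show "exp (real d) \<le> 8 ^ (4 * d)" .
          have "real N \<le> real (d * 64 ^ Suc K)" using K(2) by (simp only: of_nat_le_iff)
          then have "real N / real d \<le> 64 ^ Suc K" using d by (simp add: field_simps)
          then have "(real N / real d) ^ (d + 1) \<le> (64 ^ Suc K) ^ (d + 1)" by (intro power_mono) auto
          also have "\<dots> \<le> (64 ^ Suc K) ^ (4 * d)"
            using d one_le_power[of "64::real" "Suc K"] by (intro power_increasing) auto
          finally show "(real N / real d) ^ (d + 1) \<le> (64 ^ Suc K) ^ (4 * d)" .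
        qed auto
        also have "\<dots> = (8 * 64 ^ k) ^ (4 * d)" unfolding 3 by (rule power_mult_distrib[symmetric])
        finally show ?thesis unfolding T_def using 3 by simp
      qed
    qed
    fix x
    show "\<pi> k (active d N W b x) \<in> T k" unfolding \<pi>_def T_def using \<rho>(1)[OF AF] AF by simp
    show "\<pi> k (active d N W b x) \<subseteq> {..<N}"
    proof -
      have "\<rho> k (active d N W b x) \<in> Pow {..<N}" using \<rho>(1)[OF AF] U(1) F by blast
      then show ?thesis unfolding \<pi>_def using active_subset[of d N W b x] by simp
    qed
    show "card (sym_diff (active d N W b x) (\<pi> k (active d N W b x))) \<le> real N / 64 ^ k"
    proof -
      have "card (active d N W b x) \<le> card {..<N}" by (intro card_mono active_subset) simp
      then show ?thesis unfolding \<pi>_def using \<rho>(2)[OF AF[of x], of k] by simp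
    qed
  next
    show "\<pi> (Suc K) (active d N W b x) = active d N W b x" for x unfolding \<pi>_def by simp
    show "\<pi> 0 (active d N W b x) = {}" for x unfolding \<pi>_def by simp
  qed
qed

text \<open>Bounds the number of pairs of consecutive patterns. As
  \<open>8 * 64 ^ Suc k = 2 ^ (6 k + 9)\<close>, the exponent of 2 is at most
  \<open>8 d (6 k + 9) <= 72 d (k + 1)\<close>.\<close>

lemma card_chain_links:
  "(8 * 64 ^ k) ^ (4 * d) * (8 * 64 ^ Suc k) ^ (4 * d) \<le> exp (72 * real d * (real k + 1))"
proof -
  have e: "8 * 64 ^ Suc k = (2::real) ^ (6 * k + 9)"
    by (simp add: power_add power_mult)
  have "(8 * 64 ^ k) ^ (4 * d) * (8 * 64 ^ Suc k) ^ (4 * d)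
      \<le> (8 * 64 ^ Suc k) ^ (4 * d) * (8 * 64 ^ Suc k :: real) ^ (4 * d)"
    by (intro mult_right_mono power_mono) auto
  also have "\<dots> = 2 ^ ((6 * k + 9) * (8 * d))"
    unfolding e power_mult[symmetric] power_add[symmetric] by (simp add: algebra_simps)
  also have "\<dots> \<le> 2 ^ (72 * d * (k + 1))" by (intro power_increasing) (auto simp: algebra_simps)
  also have "\<dots> \<le> exp (real (72 * d * (k + 1)))" by (rule two_power_le_exp)
  finally show ?thesis by (simp add: algebra_simps)
qed

lemma sum_square_le_excess:
  fixes \<tau> :: real
  assumes "I \<subseteq> {..<N}" "0 \<le> \<tau>"
  shows "(\<Sum>i\<in>I. (row_form d \<sigma> v W i)\<^sup>2) \<le> card I * \<tau> + excess d N \<sigma> \<tau> v W"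
proof -
  have "(\<Sum>i\<in>I. (row_form d \<sigma> v W i)\<^sup>2) \<le> (\<Sum>i\<in>I. \<tau> + max 0 ((row_form d \<sigma> v W i)\<^sup>2 - \<tau>))"
    by (intro sum_mono) auto
  also have "\<dots> = card I * \<tau> + (\<Sum>i\<in>I. max 0 ((row_form d \<sigma> v W i)\<^sup>2 - \<tau>))"
    by (simp add: sum.distrib)
  also have "(\<Sum>i\<in>I. max 0 ((row_form d \<sigma> v W i)\<^sup>2 - \<tau>)) \<le> excess d N \<sigma> \<tau> v W"
    unfolding excess_def by (intro sum_mono2) (use assms in auto)
  finally show ?thesis by simp
qed

text \<open>First layer and biases are frozen here, so the family of patterns is fixed and every
  link is a centred Gaussian linear form in \<open>a\<close>. \<open>Bad\<close> depends on
  \<open>W\<close> and \<open>b\<close>, but its bound does not; the assumption \<open>H\<close> is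
  the only probabilistic input from the first layer.\<close>

lemma chaining_event:
  fixes u :: real
  assumes d: "1 \<le> d" and K: "d * 64 ^ K \<le> N" "N < d * 64 ^ Suc K" and u: "1 \<le> u"
    and \<sigma>: "\<sigma> = sqrt (2 / real N)"
    and H: "\<And>k v. k \<le> K \<Longrightarrow> v \<in> net d \<Longrightarrow> excess d N \<sigma> (24 * real k) v W \<le> 64 * u * real N / 8 ^ k"
  shows "\<exists>Bad\<in>sets (PiM {..<N} (\<lambda>_. gauss 1)).
    emeasure (PiM {..<N} (\<lambda>_. gauss 1)) Bad \<le> ennreal (exp (- (u * real d))) \<and>
    (\<forall>a\<in>space (PiM {..<N} (\<lambda>_. gauss 1)) - Bad. \<forall>x. \<forall>v\<in>net d.
      2 * (\<Sum>i\<in>active d N W b x. a i * (\<Sum>j<d. W (i, j) * v j)) \<le> 1000 * u * sqrt d)"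
proof -
  let ?M = "PiM {..<N} (\<lambda>_. gauss 1)"
  obtain T \<pi> where T: "\<And>k. k \<le> Suc K \<Longrightarrow> finite (T k)"
    "\<And>k. k \<le> Suc K \<Longrightarrow> real (card (T k)) \<le> (8 * 64 ^ k) ^ (4 * d)"
    and \<pi>: "\<And>k x. k \<le> Suc K \<Longrightarrow> \<pi> k (active d N W b x) \<in> T k"
    "\<And>k x. k \<le> Suc K \<Longrightarrow> \<pi> k (active d N W b x) \<subseteq> {..<N}"
    "\<And>k x. k \<le> Suc K \<Longrightarrow> card (sym_diff (active d N W b x) (\<pi> k (active d N W b x))) \<le> real N / 64 ^ k"
    "\<And>x. \<pi> (Suc K) (active d N W b x) = active d N W b x"
    "\<And>x. \<pi> 0 (active d N W b x) = {}"
    using chain_families[OF d K, of W b] by metis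
  have "d * 1 \<le> d * 64 ^ K" by (intro mult_left_mono) auto
  then have N: "1 \<le> N" using K d by linarith
  define h where "h v i = row_form d \<sigma> v W i" for v i
  define c where "c P Q v i = (of_bool (i \<in> Q) - of_bool (i \<in> P)) * h v i" for P Q v and i :: nat
  \<comment> \<open>\<open>V\<close> bounds the variance of a link: \<open>112 = 48 + 64\<close>,
    where \<open>48 = 2 * 24\<close> comes from the cut-off (one of the two factors
    \<open>8^k\<close> of \<open>64^k\<close> absorbs \<open>k\<close>) and 64 from the excess. Then
    \<open>t^2 / (2 V) = (133^2 / 224) u d 2^k\<close>, and 133 makes the factor at least
    \<open>78 = 72 + 4 + 2\<close>: pairs of patterns, directions, and the margin for
    \<open>sum_exp_levels\<close>.\<close>
  define t where "t k = 133 * u * sqrt (real d * real N) / 2 ^ k" for k :: nat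
  define V where "V k = 112 * u * real N / 8 ^ k" for k :: nat
  \<comment> \<open>All close pairs are taken, so that the bad event does not refer to
    \<open>x\<close>. The chain of any pattern produces such pairs by the triangle inequality, since
    \<open>N / 64^k + N / 64^(k + 1) <= 2 N / 64^k\<close>.\<close>
  define Pk where "Pk k = {(P, Q). P \<in> T k \<and> Q \<in> T (Suc k) \<and> P \<subseteq> {..<N} \<and> Q \<subseteq> {..<N} \<and>
    card (sym_diff P Q) \<le> 2 * real N / 64 ^ k}" for k
  define I where "I = (SIGMA k:{..K}. Pk k \<times> net d)"
  define E where "E = (\<lambda>(k, (P, Q), v). {a \<in> space ?M. t k < (\<Sum>i<N. a i * c P Q v i)})"
  define Bad where "Bad = (\<Union>p\<in>I. E p)"
  have Pk_sub: "Pk k \<subseteq> T k \<times> T (Suc k)" for k unfolding Pk_def by auto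
  have finPk: "finite (Pk k)" if "k \<le> K" for k
    using finite_subset[OF Pk_sub] T(1)[of k] T(1)[of "Suc k"] that by auto
  have finI: "finite I" unfolding I_def using finPk finite_net[OF d] by auto
  have meas: "E p \<in> sets ?M" for p unfolding E_def by (cases p) (auto split: prod.splits)
  have tail: "emeasure ?M (E (k, (P, Q), v)) \<le> ennreal (exp (- (78 * u * real d * (real k + 1))))"
    if k: "k \<le> K" and PQ: "(P, Q) \<in> Pk k" and v: "v \<in> net d" for k P Q v
  proof -
    have sub: "sym_diff P Q \<subseteq> {..<N}" using PQ unfolding Pk_def by auto
    have "(\<Sum>i<N. (c P Q v i)\<^sup>2) = (\<Sum>i<N. if i \<in> sym_diff P Q then (h v i)\<^sup>2 else 0)"
      unfolding c_def by (intro sum.cong) auto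
    also have "\<dots> = (\<Sum>i\<in>sym_diff P Q. (h v i)\<^sup>2)"
      using sub by (simp only: sum.If_cases finite_lessThan Collect_mem_eq inf.absorb2) simp
    also have "\<dots> \<le> card (sym_diff P Q) * (24 * real k) + excess d N \<sigma> (24 * real k) v W"
      unfolding h_def by (rule sum_square_le_excess[OF sub]) simp
    also have "\<dots> \<le> (2 * real N / 64 ^ k) * (24 * real k) + 64 * u * real N / 8 ^ k"
      using PQ H[OF k v] unfolding Pk_def by (intro add_mono mult_right_mono) auto
    also have "(2 * real N / 64 ^ k) * (24 * real k) \<le> 48 * u * real N / 8 ^ k"
    proof -
      have "real k \<le> 8 ^ k * u"
      proof -
        have "real k \<le> 8 ^ k * 1" using Suc_le_power_real[of 8 k] by simp
        also have "\<dots> \<le> 8 ^ k * u" using u by (intro mult_left_mono) auto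
        finally show ?thesis .
      qed
      then have le: "48 * real N / 64 ^ k * real k \<le> 48 * real N / 64 ^ k * (8 ^ k * u)"
        by (intro mult_left_mono) auto
      have e: "(64::real) ^ k = 8 ^ k * 8 ^ k" by (simp add: power_mult_distrib[symmetric])
      have "(2 * real N / 64 ^ k) * (24 * real k) = 48 * real N / 64 ^ k * real k" by simp
      also note le
      also have "48 * real N / 64 ^ k * (8 ^ k * u) = 48 * u * real N / 8 ^ k" unfolding e by simp
      finally show ?thesis .
    qed
    finally have S: "(\<Sum>i<N. (c P Q v i)\<^sup>2) \<le> V k" unfolding V_def by (simp add: field_simps)
    have Vpos: "0 < V k" and tpos: "0 < t k" unfolding V_def t_def using N d u by auto
    have "emeasure ?M (E (k, (P, Q), v)) \<le> ennreal (exp (- (t k)\<^sup>2 / (2 * V k)))"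
      unfolding E_def using gauss_linear_tail[OF S Vpos tpos] by simp
    also have "\<dots> \<le> ennreal (exp (- (78 * u * real d * (real k + 1))))"
    proof -
      have four: "((2::real) ^ k)\<^sup>2 * 2 ^ k = 8 ^ k"
        by (simp add: power2_eq_square power_mult_distrib[symmetric])
      have "(t k)\<^sup>2 = 17689 * u\<^sup>2 * (real d * real N) / (2 ^ k)\<^sup>2"
        unfolding t_def by (simp add: power_divide power_mult_distrib)
      then have "(t k)\<^sup>2 / (2 * V k) = 17689 / 224 * u * real d * 2 ^ k"
        unfolding V_def four[symmetric] using u N by (simp add: field_simps power2_eq_square)
      moreover have "78 * u * real d * (real k + 1) \<le> 17689 / 224 * u * real d * 2 ^ k"
        using Suc_le_power_real[of 2 k] u by (intro mult_mono) auto
      ultimately show ?thesis by (intro ennreal_leI) simp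
    qed
    finally show ?thesis .
  qed
  have "emeasure ?M Bad \<le> (\<Sum>p\<in>I. emeasure ?M (E p))"
    unfolding Bad_def by (rule emeasure_subadditive_finite[OF finI]) (use meas in auto)
  also have "\<dots> \<le> (\<Sum>p\<in>I. ennreal (exp (- (78 * u * real d * (real (fst p) + 1)))))"
    by (rule sum_mono) (use tail in \<open>auto simp: I_def\<close>)
  also have "\<dots> = ennreal (\<Sum>p\<in>I. exp (- (78 * u * real d * (real (fst p) + 1))))"
    by (rule sum_ennreal) auto
  also have "\<dots> \<le> ennreal (exp (- (u * real d)))"
  proof (rule ennreal_leI)
    have "(\<Sum>p\<in>I. exp (- (78 * u * real d * (real (fst p) + 1))))
        = (\<Sum>k\<le>K. \<Sum>q\<in>Pk k \<times> net d. exp (- (78 * u * real d * (real k + 1))))"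
      unfolding I_def by (subst sum.Sigma) (use finPk finite_net[OF d] in \<open>auto intro!: sum.cong\<close>)
    also have "\<dots> = (\<Sum>k\<le>K. real (card (Pk k)) * real (card (net d)) * exp (- (78 * u * real d * (real k + 1))))"
      by (simp add: card_cartesian_product)
    also have "\<dots> \<le> (\<Sum>k\<le>K. exp (- (2 * (u * real d) * (real k + 1))))"
    proof (rule sum_mono)
      fix k assume "k \<in> {..K}"
      then have k: "k \<le> K" by simp
      have "card (Pk k) \<le> card (T k \<times> T (Suc k))"
        using T(1)[of k] T(1)[of "Suc k"] k by (intro card_mono Pk_sub) auto
      then have "real (card (Pk k)) \<le> real (card (T k)) * real (card (T (Suc k)))"
        by (simp add: card_cartesian_product flip: of_nat_mult)
      also have "\<dots> \<le> (8 * 64 ^ k) ^ (4 * d) * (8 * 64 ^ Suc k) ^ (4 * d)"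
        using T(2)[of k] T(2)[of "Suc k"] k by (intro mult_mono) auto
      also have "\<dots> \<le> exp (72 * real d * (real k + 1))" by (rule card_chain_links)
      finally have 1: "real (card (Pk k)) \<le> exp (72 * real d * (real k + 1))" .
      have "real (card (Pk k)) * real (card (net d)) * exp (- (78 * u * real d * (real k + 1)))
          \<le> exp (72 * real d * (real k + 1)) * exp (4 * real d) * exp (- (78 * u * real d * (real k + 1)))"
        by (intro mult_right_mono mult_mono 1 card_net[OF d]) auto
      also have "\<dots> = exp (72 * real d * (real k + 1) + 4 * real d - 78 * u * real d * (real k + 1))"
        by (simp add: exp_add exp_diff exp_minus divide_inverse)
      also have "\<dots> \<le> exp (- (2 * (u * real d) * (real k + 1)))"
      proof -
        have a: "real d * (real k + 1) \<le> u * (real d * (real k + 1))"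
          using mult_right_mono[OF u, of "real d * (real k + 1)"] by simp
        have b: "real d \<le> real d * (real k + 1)" by (simp add: algebra_simps)
        have "72 * real d * (real k + 1) + 4 * real d \<le> 76 * (real d * (real k + 1))" using b by simp
        also have "\<dots> \<le> 76 * (u * (real d * (real k + 1)))" using a by simp
        finally show ?thesis by (simp add: algebra_simps)
      qed
      finally show "real (card (Pk k)) * real (card (net d)) * exp (- (78 * u * real d * (real k + 1)))
          \<le> exp (- (2 * (u * real d) * (real k + 1)))" .
    qed
    also have "\<dots> \<le> exp (- (u * real d))"
      using u d mult_mono[of 1 u 1 "real d"] by (intro sum_exp_levels) auto
    finally show "(\<Sum>p\<in>I. exp (- (78 * u * real d * (real (fst p) + 1)))) \<le> exp (- (u * real d))" .
  qed
  finally have small: "emeasure ?M Bad \<le> ennreal (exp (- (u * real d)))" .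
  have good: "2 * (\<Sum>i\<in>active d N W b x. a i * (\<Sum>j<d. W (i, j) * v j)) \<le> 1000 * u * sqrt d"
    if a: "a \<in> space ?M - Bad" and v: "v \<in> net d" for a x v
  proof -
    define A where "A = active d N W b x"
    define X where "X S = (\<Sum>i<N. a i * (of_bool (i \<in> S) * h v i))" for S
    have step: "X (\<pi> (Suc k) A) - X (\<pi> k A) \<le> t k" if k: "k \<le> K" for k
    proof -
      have "sym_diff (\<pi> k A) (\<pi> (Suc k) A) \<subseteq> sym_diff A (\<pi> k A) \<union> sym_diff A (\<pi> (Suc k) A)" by blast
      moreover have "finite (sym_diff A (\<pi> k A) \<union> sym_diff A (\<pi> (Suc k) A))"
        using \<pi>(2)[of k x] \<pi>(2)[of "Suc k" x] k active_subset[of d N W b x] unfolding A_def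
        by (meson finite_Diff finite_UnI finite_lessThan finite_subset le_SucI Suc_le_mono)
      ultimately have "card (sym_diff (\<pi> k A) (\<pi> (Suc k) A))
          \<le> card (sym_diff A (\<pi> k A) \<union> sym_diff A (\<pi> (Suc k) A))" by (rule card_mono[rotated])
      also have "\<dots> \<le> card (sym_diff A (\<pi> k A)) + card (sym_diff A (\<pi> (Suc k) A))" by (rule card_Un_le)
      finally have "real (card (sym_diff (\<pi> k A) (\<pi> (Suc k) A)))
          \<le> real (card (sym_diff A (\<pi> k A))) + real (card (sym_diff A (\<pi> (Suc k) A)))" by linarith
      also have "\<dots> \<le> real N / 64 ^ k + real N / 64 ^ Suc k"
        unfolding A_def using k by (intro add_mono \<pi>(3)) auto
      also have "\<dots> \<le> 2 * real N / 64 ^ k" by (simp add: field_simps)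
      finally have "(\<pi> k A, \<pi> (Suc k) A) \<in> Pk k"
        unfolding Pk_def A_def using \<pi>(1,2)[of k x] \<pi>(1,2)[of "Suc k" x] k by auto
      then have "(k, (\<pi> k A, \<pi> (Suc k) A), v) \<in> I" unfolding I_def using k v by auto
      then have "a \<notin> E (k, (\<pi> k A, \<pi> (Suc k) A), v)" using a unfolding Bad_def by blast
      then have "(\<Sum>i<N. a i * c (\<pi> k A) (\<pi> (Suc k) A) v i) \<le> t k" using a unfolding E_def by auto
      moreover have "(\<Sum>i<N. a i * c (\<pi> k A) (\<pi> (Suc k) A) v i) = X (\<pi> (Suc k) A) - X (\<pi> k A)"
        unfolding c_def X_def by (simp add: sum_subtractf[symmetric] algebra_simps)
      ultimately show ?thesis by simp
    qed
    \<comment> \<open>The chain ends at \<open>A\<close> itself, so there is no remainder term, and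
      it starts at the empty pattern, where \<open>X\<close> vanishes.\<close>
    have "X A = X (\<pi> (Suc K) A) - X (\<pi> 0 A)" using \<pi>(4,5)[of x] unfolding A_def by (simp add: X_def)
    also have "\<dots> = (\<Sum>k<Suc K. X (\<pi> (Suc k) A) - X (\<pi> k A))" by (rule sum_lessThan_telescope[symmetric])
    also have "\<dots> \<le> (\<Sum>k<Suc K. t k)" by (intro sum_mono step) auto
    also have "\<dots> = 133 * u * sqrt (real d * real N) * (\<Sum>k<Suc K. 1 / 2 ^ k)"
      unfolding t_def by (simp add: sum_distrib_left del: sum.lessThan_Suc)
    also have "(\<Sum>k<Suc K. 1 / 2 ^ k) = 2 - 1 / (2::real) ^ K" by (induction K) (auto simp: field_simps)
    also have "133 * u * sqrt (real d * real N) * \<dots> \<le> 133 * u * sqrt (real d * real N) * 2"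
      using u by (intro mult_left_mono) auto
    finally have XA: "X A \<le> 266 * u * sqrt (real d * real N)" by simp
    have "(\<Sum>j<d. W (i, j) * v j) = \<sigma> * h v i" for i unfolding h_def row_form_def \<sigma> using N by simp
    then have "(\<Sum>i\<in>A. a i * (\<Sum>j<d. W (i, j) * v j)) = \<sigma> * (\<Sum>i\<in>A. a i * h v i)"
      by (simp add: sum_distrib_left mult.left_commute)
    also have "(\<Sum>i\<in>A. a i * h v i) = (\<Sum>i<N. if i \<in> A then a i * h v i else 0)"
      using active_subset[of d N W b x] unfolding A_def by (simp add: sum.If_cases inf.absorb2)
    also have "\<dots> = X A" unfolding X_def by (intro sum.cong) auto
    also have "\<sigma> * X A \<le> \<sigma> * (266 * u * sqrt (real d * real N))"
      using XA unfolding \<sigma> by (intro mult_left_mono) auto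
    also have "\<dots> = 266 * u * (sqrt 2 * sqrt (real d))"
      unfolding \<sigma> using N by (simp add: real_sqrt_mult real_sqrt_divide)
    also have "\<dots> \<le> 266 * u * (3 / 2 * sqrt (real d))"
    proof -
      have "sqrt 2 \<le> 3 / 2" by (rule real_le_lsqrt) (auto simp: power_divide)
      then show ?thesis using u by (intro mult_left_mono mult_right_mono) auto
    qed
    finally have "2 * (\<Sum>i\<in>A. a i * (\<Sum>j<d. W (i, j) * v j)) \<le> 798 * u * sqrt (real d)" by simp
    also have "\<dots> \<le> 1000 * u * sqrt (real d)" using u by (intro mult_right_mono) auto
    finally show ?thesis unfolding A_def .
  qed
  have "Bad \<in> sets ?M" unfolding Bad_def using finI meas by auto
  then show ?thesis using small good by blast
qed

text \<open>The cut-off \<open>24 k\<close> is chosen so that \<open>exp (- 24 k / 8) \<le> 1 / 8\<^sup>k\<close>.\<close>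

lemma wide_first_layer_event:
  fixes u :: real
  assumes d: "1 \<le> d" and K: "d * 64 ^ K \<le> N" and u: "1 \<le> u" and \<sigma>: "0 < \<sigma>"
  shows "\<exists>G\<in>sets (PiM ({..<N} \<times> {..<d}) (\<lambda>_. gauss \<sigma>)).
    emeasure (PiM ({..<N} \<times> {..<d}) (\<lambda>_. gauss \<sigma>)) G \<le> ennreal (exp (- (u * real d))) \<and>
    (\<forall>W\<in>space (PiM ({..<N} \<times> {..<d}) (\<lambda>_. gauss \<sigma>)) - G. \<forall>k\<le>K. \<forall>v\<in>net d.
      excess d N \<sigma> (24 * real k) v W \<le> 64 * u * real N / 8 ^ k)"
proof -
  let ?P = "PiM ({..<N} \<times> {..<d}) (\<lambda>_. gauss \<sigma>)"
  define E where "E = (\<lambda>(k, v). {W \<in> space ?P. 64 * u * real N / 8 ^ k < excess d N \<sigma> (24 * real k) v W})"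
  define G where "G = (\<Union>p\<in>{..K} \<times> net d. E p)"
  have fin: "finite ({..K} \<times> net d)" using finite_net[OF d] by auto
  have meas: "E p \<in> sets ?P" for p unfolding E_def by (cases p) auto
  have tail: "emeasure ?P (E (k, v)) \<le> ennreal (exp (- (6 * (u * real d) * (real k + 1))))"
    if k: "k \<le> K" and v: "v \<in> net d" for k v
  proof -
    have "emeasure ?P (E (k, v)) \<le> ennreal (exp (2 * real N * exp (- (24 * real k) / 8) - 64 * u * real N / 8 ^ k / 8))"
      unfolding E_def prod.case by (rule excess_tail[OF \<sigma> net_norm_le[OF v d]])
    also have "\<dots> \<le> ennreal (exp (- (6 * (u * real d) * (real k + 1))))"
    proof (intro ennreal_leI, subst exp_le_cancel_iff)
      have "(8::real) ^ k = 2 ^ (3 * k)" by (simp add: power_mult)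
      also have "\<dots> \<le> exp (real (3 * k))" by (rule two_power_le_exp)
      finally have "exp (- (24 * real k) / 8) \<le> 1 / 8 ^ k"
        by (simp add: exp_minus inverse_eq_divide divide_left_mono)
      then have "2 * real N * exp (- (24 * real k) / 8) \<le> 2 * real N * (1 / 8 ^ k)"
        by (intro mult_left_mono) auto
      also have "\<dots> \<le> u * (2 * real N / 8 ^ k)"
        using mult_right_mono[OF u, of "2 * real N / 8 ^ k"] by simp
      \<comment> \<open>The budget: \<open>64 / 8 = 8\<close> pays 2 for the exponential moment and
        leaves 6, of which 4 will cover the directions and 2 goes to
        \<open>sum_exp_levels\<close>.\<close>
      finally have 1: "2 * real N * exp (- (24 * real k) / 8) - 64 * u * real N / 8 ^ k / 8 \<le> - (6 * u * (real N / 8 ^ k))"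
        by simp
      \<comment> \<open>The point at which the length of the chain is limited:
        \<open>d * 8^k <= N / 8^k\<close> holds for \<open>k <= K\<close>, so the tail exponent
        dominates \<open>d (k + 1)\<close> at every level.\<close>
      have "(8::real) ^ k * 8 ^ k = 64 ^ k" by (simp add: power_mult_distrib[symmetric])
      also have "(64::real) ^ k \<le> 64 ^ K" using k by (intro power_increasing) auto
      finally have "real d * (8 ^ k * 8 ^ k) \<le> real d * 64 ^ K" by (intro mult_left_mono) auto
      also have "\<dots> = real (d * 64 ^ K)" by simp
      also have "\<dots> \<le> real N" using K by (simp only: of_nat_le_iff)
      finally have "real d * 8 ^ k \<le> real N / 8 ^ k" by (simp add: field_simps)
      moreover have "real d * (real k + 1) \<le> real d * 8 ^ k"
        using Suc_le_power_real[of 8 k] by (intro mult_left_mono) auto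
      ultimately have 2: "6 * u * (real d * (real k + 1)) \<le> 6 * u * (real N / 8 ^ k)"
        using u by (intro mult_left_mono) auto
      have 3: "6 * (u * real d) * (real k + 1) = 6 * u * (real d * (real k + 1))" by (simp only: mult_ac)
      show "2 * real N * exp (- (24 * real k) / 8) - 64 * u * real N / 8 ^ k / 8 \<le> - (6 * (u * real d) * (real k + 1))"
        using 1 2 unfolding 3 by linarith
    qed
    finally show ?thesis .
  qed
  have "emeasure ?P G \<le> (\<Sum>p\<in>{..K} \<times> net d. emeasure ?P (E p))"
    unfolding G_def by (rule emeasure_subadditive_finite[OF fin]) (use meas in auto)
  also have "\<dots> \<le> (\<Sum>p\<in>{..K} \<times> net d. ennreal (exp (- (6 * (u * real d) * (real (fst p) + 1)))))"
    by (rule sum_mono) (use tail in auto)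
  also have "\<dots> = ennreal (\<Sum>p\<in>{..K} \<times> net d. exp (- (6 * (u * real d) * (real (fst p) + 1))))"
    by (rule sum_ennreal) auto
  also have "\<dots> \<le> ennreal (exp (- (u * real d)))"
  proof (rule ennreal_leI)
    have "(\<Sum>p\<in>{..K} \<times> net d. exp (- (6 * (u * real d) * (real (fst p) + 1))))
        = (\<Sum>k\<le>K. \<Sum>v\<in>net d. exp (- (6 * (u * real d) * (real k + 1))))"
      by (subst sum.cartesian_product) (auto intro!: sum.cong)
    also have "\<dots> = (\<Sum>k\<le>K. real (card (net d)) * exp (- (6 * (u * real d) * (real k + 1))))" by simp
    also have "\<dots> \<le> (\<Sum>k\<le>K. exp (- (2 * (u * real d) * (real k + 1))))"
    proof (rule sum_mono)
      fix k
      have "real (card (net d)) * exp (- (6 * (u * real d) * (real k + 1)))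
          \<le> exp (4 * real d) * exp (- (6 * (u * real d) * (real k + 1)))"
        by (intro mult_right_mono card_net[OF d]) auto
      also have "\<dots> = exp (4 * real d - 6 * (u * real d) * (real k + 1))"
        by (simp add: exp_diff exp_minus divide_inverse)
      also have "\<dots> \<le> exp (- (2 * (u * real d) * (real k + 1)))"
      proof -
        have "1 * (real d * 1) \<le> u * (real d * (real k + 1))" using u by (intro mult_mono) auto
        then show ?thesis by (simp add: algebra_simps)
      qed
      finally show "real (card (net d)) * exp (- (6 * (u * real d) * (real k + 1)))
          \<le> exp (- (2 * (u * real d) * (real k + 1)))" .
    qed
    also have "\<dots> \<le> exp (- (u * real d))"
      using u d mult_mono[of 1 u 1 "real d"] by (intro sum_exp_levels) auto
    finally show "(\<Sum>p\<in>{..K} \<times> net d. exp (- (6 * (u * real d) * (real (fst p) + 1)))) \<le> exp (- (u * real d))" .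
  qed
  finally have "emeasure ?P G \<le> ennreal (exp (- (u * real d)))" .
  moreover have "G \<in> sets ?P" unfolding G_def using fin meas by auto
  moreover have "excess d N \<sigma> (24 * real k) v W \<le> 64 * u * real N / 8 ^ k"
    if "W \<in> space ?P - G" "k \<le> K" "v \<in> net d" for W k v
    using that unfolding G_def E_def by (auto simp: not_less)
  ultimately show ?thesis by blast
qed

text \<open>With at most \<open>d\<close> rows the moment \<open>exp (2 N)\<close> is no larger than
  \<open>exp (2 d)\<close>, comparable to the number of directions, so the full sum of squares is
  controlled without a cut-off. The constant is \<open>56 / 8 = 7 = 2 + 4 + 1\<close>: moment,
  directions, and the remaining exponent.\<close>

lemma narrow_first_layer_event:
  fixes u :: real
  assumes d: "1 \<le> d" and N: "N \<le> d" and u: "1 \<le> u" and \<sigma>: "0 < \<sigma>"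
  shows "\<exists>G\<in>sets (PiM ({..<N} \<times> {..<d}) (\<lambda>_. gauss \<sigma>)).
    emeasure (PiM ({..<N} \<times> {..<d}) (\<lambda>_. gauss \<sigma>)) G \<le> ennreal (exp (- (u * real d))) \<and>
    (\<forall>W\<in>space (PiM ({..<N} \<times> {..<d}) (\<lambda>_. gauss \<sigma>)) - G. \<forall>v\<in>net d.
      excess d N \<sigma> 0 v W \<le> 56 * u * real d)"
proof -
  let ?P = "PiM ({..<N} \<times> {..<d}) (\<lambda>_. gauss \<sigma>)"
  define E where "E v = {W \<in> space ?P. 56 * u * real d < excess d N \<sigma> 0 v W}" for v
  define G where "G = (\<Union>v\<in>net d. E v)"
  have fin: "finite (net d)" by (rule finite_net[OF d])
  have meas: "E v \<in> sets ?P" for v unfolding E_def by auto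
  have tail: "emeasure ?P (E v) \<le> ennreal (exp (2 * real d - 7 * u * real d))" if v: "v \<in> net d" for v
  proof -
    have "emeasure ?P (E v) \<le> ennreal (exp (2 * real N * exp (- 0 / 8) - 56 * u * real d / 8))"
      unfolding E_def by (rule excess_tail[OF \<sigma> net_norm_le[OF v d]])
    also have "\<dots> \<le> ennreal (exp (2 * real d - 7 * u * real d))" using N by (intro ennreal_leI) simp
    finally show ?thesis .
  qed
  have "emeasure ?P G \<le> (\<Sum>v\<in>net d. emeasure ?P (E v))"
    unfolding G_def by (rule emeasure_subadditive_finite[OF fin]) (use meas in auto)
  also have "\<dots> \<le> (\<Sum>v\<in>net d. ennreal (exp (2 * real d - 7 * u * real d)))"
    by (rule sum_mono) (use tail in auto)
  also have "\<dots> = ennreal (\<Sum>v\<in>net d. exp (2 * real d - 7 * u * real d))"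
    by (rule sum_ennreal) auto
  also have "\<dots> \<le> ennreal (exp (- (u * real d)))"
  proof (rule ennreal_leI)
    have "(\<Sum>v\<in>net d. exp (2 * real d - 7 * u * real d)) \<le> exp (4 * real d) * exp (2 * real d - 7 * u * real d)"
      using card_net[OF d] by simp
    also have "\<dots> \<le> exp (- (u * real d))"
      using mult_right_mono[OF u, of "real d"] by (simp add: exp_add[symmetric])
    finally show "(\<Sum>v\<in>net d. exp (2 * real d - 7 * u * real d)) \<le> exp (- (u * real d))" .
  qed
  finally have "emeasure ?P G \<le> ennreal (exp (- (u * real d)))" .
  moreover have "G \<in> sets ?P" unfolding G_def using fin meas by auto
  moreover have "excess d N \<sigma> 0 v W \<le> 56 * u * real d" if "W \<in> space ?P - G" "v \<in> net d" for W v
    using that unfolding G_def E_def by (auto simp: not_less)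
  ultimately show ?thesis by blast
qed

text \<open>The patterns need no counting: both factors of Cauchy-Schwarz only grow when the sum
  runs over all rows. The squared norm of \<open>a\<close> deviates with exponent of order
  \<open>N\<close>, whereas the first layer has exponent of order \<open>d\<close>; hence
  \<open>min d N\<close> in the final tail.\<close>

lemma cauchy_schwarz_event:
  fixes u :: real
  assumes d: "1 \<le> d" and N: "1 \<le> N" and u: "1 \<le> u" and \<sigma>: "\<sigma> = sqrt (2 / real N)"
    and H: "\<And>v. v \<in> net d \<Longrightarrow> excess d N \<sigma> 0 v W \<le> 56 * u * real d"
  shows "\<exists>Bad\<in>sets (PiM {..<N} (\<lambda>_. gauss 1)).
    emeasure (PiM {..<N} (\<lambda>_. gauss 1)) Bad \<le> ennreal (exp (- (u * real N))) \<and>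
    (\<forall>a\<in>space (PiM {..<N} (\<lambda>_. gauss 1)) - Bad. \<forall>x. \<forall>v\<in>net d.
      2 * (\<Sum>i\<in>active d N W b x. a i * (\<Sum>j<d. W (i, j) * v j)) \<le> 1000 * u * sqrt d)"
proof -
  let ?M = "PiM {..<N} (\<lambda>_. gauss 1)"
  define Bad where "Bad = {a \<in> space ?M. 16 * u * real N < (\<Sum>i<N. (a i)\<^sup>2)}"
  have "emeasure ?M Bad \<le> ennreal (exp (real N - 16 * u * real N / 8))"
    unfolding Bad_def by (rule gauss_square_sum_tail)
  also have "\<dots> \<le> ennreal (exp (- (u * real N)))"
    using mult_right_mono[OF u, of "real N"] by (intro ennreal_leI) simp
  finally have small: "emeasure ?M Bad \<le> ennreal (exp (- (u * real N)))" .
  have good: "2 * (\<Sum>i\<in>active d N W b x. a i * (\<Sum>j<d. W (i, j) * v j)) \<le> 1000 * u * sqrt d"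
    if a: "a \<in> space ?M - Bad" and v: "v \<in> net d" for a x v
  proof -
    define A where "A = active d N W b x"
    have AN: "A \<subseteq> {..<N}" unfolding A_def by (rule active_subset)
    define h where "h i = row_form d \<sigma> v W i" for i
    have "(\<Sum>i\<in>A. a i * h i) \<le> sqrt ((\<Sum>i\<in>A. a i * h i)\<^sup>2)" by simp
    also have "\<dots> \<le> sqrt ((\<Sum>i\<in>A. (a i)\<^sup>2) * (\<Sum>i\<in>A. (h i)\<^sup>2))"
      by (intro real_sqrt_le_mono Cauchy_Schwarz_ineq_sum)
    also have "\<dots> \<le> sqrt ((16 * u * real N) * (56 * u * real d))"
    proof (intro real_sqrt_le_mono mult_mono)
      have "(\<Sum>i\<in>A. (a i)\<^sup>2) \<le> (\<Sum>i<N. (a i)\<^sup>2)" by (intro sum_mono2 AN) auto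
      also have "\<dots> \<le> 16 * u * real N" using a unfolding Bad_def by auto
      finally show "(\<Sum>i\<in>A. (a i)\<^sup>2) \<le> 16 * u * real N" .
      have "(\<Sum>i\<in>A. (h i)\<^sup>2) \<le> real (card A) * 0 + excess d N \<sigma> 0 v W"
        unfolding h_def by (rule sum_square_le_excess[OF AN]) simp
      then show "(\<Sum>i\<in>A. (h i)\<^sup>2) \<le> 56 * u * real d" using H[OF v] by simp
    qed (use u in \<open>auto intro: sum_nonneg\<close>)
    finally have X: "(\<Sum>i\<in>A. a i * h i) \<le> sqrt ((16 * u * real N) * (56 * u * real d))" .
    have "(\<Sum>j<d. W (i, j) * v j) = \<sigma> * h i" for i unfolding h_def row_form_def \<sigma> using N by simp
    then have "(\<Sum>i\<in>A. a i * (\<Sum>j<d. W (i, j) * v j)) = \<sigma> * (\<Sum>i\<in>A. a i * h i)"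
      by (simp add: sum_distrib_left mult.left_commute)
    also have "\<dots> \<le> \<sigma> * sqrt ((16 * u * real N) * (56 * u * real d))"
      using X unfolding \<sigma> by (intro mult_left_mono) auto
    \<comment> \<open>The variance \<open>2 / N\<close> cancels the \<open>N\<close> from the norm
      of \<open>a\<close>: \<open>2 * 16 * 56 = 1792\<close>.\<close>
    also have "\<dots> = sqrt (1792 * (u\<^sup>2 * real d))"
      unfolding \<sigma> real_sqrt_mult[symmetric] using N by (simp add: power2_eq_square)
    also have "\<dots> \<le> sqrt (500\<^sup>2 * (u\<^sup>2 * real d))"
      by (intro real_sqrt_le_mono mult_right_mono) auto
    also have "\<dots> = 500 * u * sqrt (real d)" unfolding real_sqrt_mult using u by simp
    finally show ?thesis unfolding A_def by simp
  qed
  have "Bad \<in> sets ?M" unfolding Bad_def by measurable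
  then show ?thesis using small good by blast
qed

section \<open>Tail bound for the Lipschitz constant\<close>

lemma exists_scale:
  fixes d N :: nat
  assumes "1 \<le> d" "d \<le> N"
  shows "\<exists>K. d * 64 ^ K \<le> N \<and> N < d * 64 ^ Suc K"
proof -
  define K where "K = (GREATEST k. d * 64 ^ k \<le> N)"
  have bd: "k \<le> N" if "d * 64 ^ k \<le> N" for k
  proof -
    have "k < 64 ^ k" by (rule power_gt_expt) simp
    also have "\<dots> \<le> d * 64 ^ k" using assms by simp
    finally show ?thesis using that by simp
  qed
  have "d * 64 ^ K \<le> N" unfolding K_def by (rule GreatestI_nat[where k=0 and b=N]) (use assms bd in auto)
  moreover have "\<not> d * 64 ^ Suc K \<le> N"
  proof
    assume "d * 64 ^ Suc K \<le> N"
    then have "Suc K \<le> K" unfolding K_def by (rule Greatest_le_nat[where b=N]) (use bd in auto)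
    then show False by simp
  qed
  ultimately show ?thesis by (auto simp: not_le)
qed

text \<open>Two exceptional events, each of probability at most \<open>exp (- u min d N)\<close>:
  one for the first layer, and one for the second layer given the first layer and the biases. Hence
  the factor 2.\<close>

lemma Lip_tail:
  fixes u :: real and B0 :: "(nat \<Rightarrow> real) measure" and D1 :: "real measure"
  assumes d: "1 \<le> d" and N: "1 \<le> N" and u: "1 \<le> u"
    and B0: "prob_space B0" "sets B0 = sets (PiM {..<N} (\<lambda>_. borel))"
    and D1: "prob_space D1" "sets D1 = sets borel"
  shows "emeasure (param_law d N B0 D1)
      {\<theta> \<in> space (param_law d N B0 D1). ennreal (1000 * u * sqrt d) < Lip d (shallow_net d N \<theta>)}
    \<le> ennreal (2 * exp (- (u * real (min d N))))"
proof -
  define \<sigma> where "\<sigma> = sqrt (2 / real N)"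
  have \<sigma>: "0 < \<sigma>" unfolding \<sigma>_def using N by simp
  let ?P0 = "PiM ({..<N} \<times> {..<d}) (\<lambda>_. gauss \<sigma>)"
  let ?M = "PiM {..<N} (\<lambda>_. gauss 1)"
  define \<delta> where "\<delta> = ennreal (exp (- (u * real (min d N))))"
  define E where "E = {\<theta> \<in> space (param_law d N B0 D1). ennreal (1000 * u * sqrt d) < Lip d (shallow_net d N \<theta>)}"
  have law: "param_law d N B0 D1 = ?P0 \<Otimes>\<^sub>M (?M \<Otimes>\<^sub>M (B0 \<Otimes>\<^sub>M D1))"
    unfolding param_law_def \<sigma>_def ..
  have E: "E \<in> sets (param_law d N B0 D1)"
    unfolding E_def using Lip_measurable[OF B0(2) D1(2)] by measurable
  have weak: "ennreal (exp (- (u * real d))) \<le> \<delta>" "ennreal (exp (- (u * real N))) \<le> \<delta>"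
    unfolding \<delta>_def using u by (auto intro!: ennreal_leI mult_left_mono)
  \<comment> \<open>\<open>G\<close> is chosen before the bias \<open>b\<close> and
    \<open>Bad\<close> after it; this order of quantifiers is what
    \<open>emeasure_triple_section_bound\<close> asks for.\<close>
  have "\<exists>G\<in>sets ?P0. emeasure ?P0 G \<le> \<delta> \<and> (\<forall>W\<in>space ?P0 - G. \<forall>b. \<exists>Bad\<in>sets ?M. emeasure ?M Bad \<le> \<delta> \<and>
    (\<forall>a\<in>space ?M - Bad. \<forall>x. \<forall>v\<in>net d.
      2 * (\<Sum>i\<in>active d N W b x. a i * (\<Sum>j<d. W (i, j) * v j)) \<le> 1000 * u * sqrt d))"
  proof (cases "d \<le> N")
    case True
    obtain K where K: "d * 64 ^ K \<le> N" "N < d * 64 ^ Suc K" using exists_scale[OF d True] by blast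
    obtain G where G: "G \<in> sets ?P0" "emeasure ?P0 G \<le> ennreal (exp (- (u * real d)))"
      "\<And>W k v. W \<in> space ?P0 - G \<Longrightarrow> k \<le> K \<Longrightarrow> v \<in> net d \<Longrightarrow>
        excess d N \<sigma> (24 * real k) v W \<le> 64 * u * real N / 8 ^ k"
      using wide_first_layer_event[OF d K(1) u \<sigma>] by blast
    show ?thesis
    proof (intro bexI[of _ G] conjI ballI allI G(1))
      show "emeasure ?P0 G \<le> \<delta>" using G(2) weak(1) by (rule order_trans)
      fix W b assume W: "W \<in> space ?P0 - G"
      show "\<exists>Bad\<in>sets ?M. emeasure ?M Bad \<le> \<delta> \<and> (\<forall>a\<in>space ?M - Bad. \<forall>x. \<forall>v\<in>net d.
        2 * (\<Sum>i\<in>active d N W b x. a i * (\<Sum>j<d. W (i, j) * v j)) \<le> 1000 * u * sqrt d)"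
        using chaining_event[OF d K u \<sigma>_def G(3)[OF W], of b] weak(1) by (meson order_trans)
    qed
  next
    case False
    then have Nd: "N \<le> d" by simp
    obtain G where G: "G \<in> sets ?P0" "emeasure ?P0 G \<le> ennreal (exp (- (u * real d)))"
      "\<And>W v. W \<in> space ?P0 - G \<Longrightarrow> v \<in> net d \<Longrightarrow> excess d N \<sigma> 0 v W \<le> 56 * u * real d"
      using narrow_first_layer_event[OF d Nd u \<sigma>] by blast
    show ?thesis
    proof (intro bexI[of _ G] conjI ballI allI G(1))
      show "emeasure ?P0 G \<le> \<delta>" using G(2) weak(1) by (rule order_trans)
      fix W b assume W: "W \<in> space ?P0 - G"
      show "\<exists>Bad\<in>sets ?M. emeasure ?M Bad \<le> \<delta> \<and> (\<forall>a\<in>space ?M - Bad. \<forall>x. \<forall>v\<in>net d.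
        2 * (\<Sum>i\<in>active d N W b x. a i * (\<Sum>j<d. W (i, j) * v j)) \<le> 1000 * u * sqrt d)"
        using cauchy_schwarz_event[OF d N u \<sigma>_def G(3)[OF W], of b] weak(2) by (meson order_trans)
    qed
  qed
  then obtain G where G: "G \<in> sets ?P0" "emeasure ?P0 G \<le> \<delta>"
    and sec: "\<And>W b. W \<in> space ?P0 - G \<Longrightarrow> \<exists>Bad\<in>sets ?M. emeasure ?M Bad \<le> \<delta> \<and>
    (\<forall>a\<in>space ?M - Bad. \<forall>x. \<forall>v\<in>net d.
      2 * (\<Sum>i\<in>active d N W b x. a i * (\<Sum>j<d. W (i, j) * v j)) \<le> 1000 * u * sqrt d)"
    by blast
  have "emeasure (?P0 \<Otimes>\<^sub>M (?M \<Otimes>\<^sub>M (B0 \<Otimes>\<^sub>M D1))) E \<le> \<delta> + \<delta>"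
  proof (rule emeasure_triple_section_bound)
    show "prob_space ?P0" "prob_space ?M" by (intro prob_space_PiM_gauss \<sigma> zero_less_one)+
    show "prob_space (B0 \<Otimes>\<^sub>M D1)" by (intro prob_space_pair B0 D1)
    show "E \<in> sets (?P0 \<Otimes>\<^sub>M (?M \<Otimes>\<^sub>M (B0 \<Otimes>\<^sub>M D1)))" using E unfolding law .
    fix W and q :: "(nat \<Rightarrow> real) \<times> real" assume W: "W \<in> space ?P0" "W \<notin> G"
    obtain b0 b1 where q: "q = (b0, b1)" by (cases q)
    obtain Bad where Bad: "Bad \<in> sets ?M" "emeasure ?M Bad \<le> \<delta>"
      "\<And>a x v. a \<in> space ?M - Bad \<Longrightarrow> v \<in> net d \<Longrightarrow>
        2 * (\<Sum>i\<in>active d N W b0 x. a i * (\<Sum>j<d. W (i, j) * v j)) \<le> 1000 * u * sqrt d"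
      using sec[of W b0] W by blast
    have "{a \<in> space ?M. (W, a, q) \<in> E} \<subseteq> Bad"
    proof (rule subsetI, rule ccontr)
      fix a assume a: "a \<in> {a \<in> space ?M. (W, a, q) \<in> E}" "a \<notin> Bad"
      have "Lip d (shallow_net d N (W, a, b0, b1)) \<le> ennreal (1000 * u * sqrt d)"
        by (rule Lip_shallow_net_le[OF d Bad(3)]) (use a in auto)
      then show False using a unfolding E_def q by (auto simp: not_less[symmetric])
    qed
    then have "emeasure ?M {a \<in> space ?M. (W, a, q) \<in> E} \<le> emeasure ?M Bad"
      by (rule emeasure_mono[OF _ Bad(1)])
    then show "emeasure ?M {a \<in> space ?M. (W, a, q) \<in> E} \<le> \<delta>" using Bad(2) by (rule order_trans)
  qed (use G in auto)
  also have "\<delta> + \<delta> = ennreal (2 * exp (- (u * real (min d N))))"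
    unfolding \<delta>_def by (simp flip: ennreal_plus)
  finally show ?thesis unfolding E_def law .
qed

section \<open>Expectation and conclusion\<close>

lemma prob_space_param_law:
  assumes "1 \<le> N" "prob_space B0" "prob_space D1"
  shows "prob_space (param_law d N B0 D1)"
  unfolding param_law_def using assms by (intro prob_space_pair prob_space_PiM_gauss) auto

text \<open>Layer cake: if \<open>n\<close> is the first index with \<open>y \<le> (n + 1) c\<close> then \<open>y\<close> exceeds exactly
  the thresholds \<open>c, \<dots>, n c\<close>.\<close>

lemma ennreal_le_count_exceedances:
  fixes c :: real and y :: ennreal
  assumes "0 < c"
  shows "y \<le> ennreal c * (1 + (\<Sum>n. of_bool (ennreal (real (Suc n) * c) < y)))"
proof (cases "\<exists>n. y \<le> ennreal (real (Suc n) * c)")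
  case True
  define m where "m = (LEAST n. y \<le> ennreal (real (Suc n) * c))"
  have m: "y \<le> ennreal (real (Suc m) * c)" unfolding m_def using True by (rule LeastI_ex)
  have lt: "ennreal (real (Suc n) * c) < y" if "n < m" for n
    using not_less_Least[OF that[unfolded m_def]] by (simp add: not_le)
  have "of_nat m = (\<Sum>n<m. of_bool (ennreal (real (Suc n) * c) < y) :: ennreal)" using lt by simp
  also have "\<dots> \<le> (\<Sum>n. of_bool (ennreal (real (Suc n) * c) < y))"
    by (rule sum_le_suminf) auto
  finally have "1 + of_nat m \<le> 1 + (\<Sum>n. of_bool (ennreal (real (Suc n) * c) < y) :: ennreal)"
    by (rule add_left_mono)
  then have "ennreal c * (1 + of_nat m) \<le> ennreal c * (1 + (\<Sum>n. of_bool (ennreal (real (Suc n) * c) < y)))"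
    by (intro mult_left_mono) auto
  moreover have "ennreal (real (Suc m) * c) = ennreal c * (1 + of_nat m)"
  proof -
    have "ennreal (real (Suc m) * c) = ennreal (c * (1 + real m))" by (simp add: algebra_simps)
    also have "\<dots> = ennreal c * ennreal (1 + real m)" using assms by (intro ennreal_mult) auto
    also have "ennreal (1 + real m) = 1 + of_nat m"
      by (subst ennreal_plus) (auto simp: ennreal_of_nat_eq_real_of_nat)
    finally show ?thesis .
  qed
  ultimately show ?thesis using m by simp
next
  case False
  then have "(\<Sum>n. of_bool (ennreal (real (Suc n) * c) < y)) = (\<Sum>n. 1 :: ennreal)" by (simp add: not_le)
  also have "\<dots> = \<infinity>"
  proof (rule ccontr)
    assume "(\<Sum>n. 1 :: ennreal) \<noteq> \<infinity>"
    then obtain n where "(\<Sum>n. 1 :: ennreal) < of_nat n" using ennreal_Ex_less_of_nat[of "\<Sum>n. 1"] by (auto simp: top.not_eq_extremum)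
    moreover have "(\<Sum>k<n. 1 :: ennreal) \<le> (\<Sum>n. 1 :: ennreal)" by (rule sum_le_suminf) auto
    ultimately show False by (simp add: not_le[symmetric])
  qed
  finally show ?thesis using assms by (simp add: ennreal_mult_top)
qed

text \<open>The tail at \<open>u = n + 1\<close> is at most \<open>2 * (1/2)^(n + 1)\<close>,
  because \<open>min d N >= 1\<close>. These bounds sum to 2, and the layer-cake bound gives
  \<open>1000 * (1 + 2)\<close>.\<close>

lemma nn_integral_Lip_le:
  assumes d: "1 \<le> d" and N: "1 \<le> N"
    and B0: "prob_space B0" "sets B0 = sets (PiM {..<N} (\<lambda>_. borel))"
    and D1: "prob_space D1" "sets D1 = sets borel"
  shows "(\<integral>\<^sup>+ \<theta>. Lip d (shallow_net d N \<theta>) \<partial>(param_law d N B0 D1)) \<le> ennreal (3000 * sqrt d)"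
proof -
  let ?L = "param_law d N B0 D1"
  interpret L: prob_space ?L by (rule prob_space_param_law[OF N B0(1) D1(1)])
  define c where "c = 1000 * sqrt d"
  have c: "0 < c" unfolding c_def using d by simp
  note [measurable] = Lip_measurable[OF B0(2) D1(2), of d]
  let ?E = "\<lambda>n. {\<theta> \<in> space ?L. ennreal (real (Suc n) * c) < Lip d (shallow_net d N \<theta>)}"
  have "(\<integral>\<^sup>+ \<theta>. Lip d (shallow_net d N \<theta>) \<partial>?L)
      \<le> (\<integral>\<^sup>+ \<theta>. ennreal c * (1 + (\<Sum>n. indicator (?E n) \<theta>)) \<partial>?L)"
  proof (rule nn_integral_mono)
    fix \<theta> assume "\<theta> \<in> space ?L"
    then show "Lip d (shallow_net d N \<theta>) \<le> ennreal c * (1 + (\<Sum>n. indicator (?E n) \<theta>))"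
      using ennreal_le_count_exceedances[OF c, of "Lip d (shallow_net d N \<theta>)"]
      by (simp add: indicator_def of_bool_def)
  qed
  also have "\<dots> = ennreal c * (1 + (\<Sum>n. emeasure ?L (?E n)))"
    by (subst nn_integral_cmult, measurable, subst nn_integral_add, measurable, subst nn_integral_suminf, measurable)
       (simp add: L.emeasure_space_1)
  also have "\<dots> \<le> ennreal c * (1 + (\<Sum>n. ennreal (2 * (1/2) ^ Suc n)))"
  proof (intro mult_left_mono add_left_mono suminf_le)
    fix n
    have "emeasure ?L (?E n) \<le> ennreal (2 * exp (- (real (Suc n) * real (min d N))))"
      using Lip_tail[OF d N _ B0 D1, of "real (Suc n)"] unfolding c_def by (simp add: mult_ac)
    also have "\<dots> \<le> ennreal (2 * (1/2) ^ Suc n)"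
    proof (intro ennreal_leI mult_left_mono)
      have "real (Suc n) * 1 \<le> real (Suc n) * real (min d N)" using d N by (intro mult_left_mono) auto
      then have "exp (- (real (Suc n) * real (min d N))) \<le> exp (- real (Suc n))"
        by (simp only: exp_le_cancel_iff neg_le_iff_le mult_1_right)
      also have "\<dots> \<le> (1/2) ^ Suc n"
        unfolding power_one_over exp_minus inverse_eq_divide
        using two_power_le_exp[of "Suc n"] by (intro divide_left_mono) auto
      finally show "exp (- (real (Suc n) * real (min d N))) \<le> (1/2) ^ Suc n" .
    qed simp
    finally show "emeasure ?L (?E n) \<le> ennreal (2 * (1/2) ^ Suc n)" .
  qed auto
  also have "(\<Sum>n. ennreal (2 * (1/2) ^ Suc n)) = ennreal 2"
    using sums_mult[OF power_half_series, of 2] by (intro suminf_ennreal_eq) auto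
  also have "ennreal c * (1 + ennreal 2) = ennreal (3000 * sqrt d)"
  proof -
    have "1 + ennreal 2 = ennreal (1 + 2)" by (subst ennreal_plus) auto
    then show ?thesis using c unfolding c_def by (simp add: ennreal_mult[symmetric] del: ennreal_numeral)
  qed
  finally show ?thesis .
qed

theorem theorem3p1:
  shows "\<exists>C c1 :: real. C > 0 \<and> c1 > 0 \<and>
    (\<forall>(d::nat) (N::nat) (B0 :: (nat \<Rightarrow> real) measure) (D1 :: real measure).
       d \<ge> 1 \<longrightarrow> N \<ge> 1 \<longrightarrow>
       prob_space B0 \<longrightarrow> sets B0 = sets (PiM {..<N} (\<lambda>_. borel)) \<longrightarrow>
       prob_space D1 \<longrightarrow> sets D1 = sets borel \<longrightarrow>
       (\<exists>A \<in> sets (param_law d N B0 D1).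
           A \<subseteq> {\<theta> \<in> space (param_law d N B0 D1).
                   Lip d (shallow_net d N \<theta>) \<le> ennreal (C * sqrt (real d))} \<and>
           measure (param_law d N B0 D1) A \<ge>
             (1 - 2 * exp (- real (min d N))) *
             max 0 (1 - 2 * exp (- c1 * real (max d N))))
       \<and> (\<integral>\<^sup>+ \<theta>. Lip d (shallow_net d N \<theta>) \<partial>(param_law d N B0 D1))
            \<le> ennreal (C * sqrt (real d)))"
\<comment> \<open>3000 is dictated by the expectation; the probability bound is obtained at the
  level 1000, that is at \<open>u = 1\<close>.\<close>
proof (rule exI[of _ 3000], rule exI[of _ 1], intro conjI allI impI)
  fix d N :: nat and B0 :: "(nat \<Rightarrow> real) measure" and D1 :: "real measure"
  assume d: "d \<ge> 1" and N: "N \<ge> 1"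
    and B0: "prob_space B0" "sets B0 = sets (PiM {..<N} (\<lambda>_. borel))"
    and D1: "prob_space D1" "sets D1 = sets borel"
  let ?L = "param_law d N B0 D1"
  interpret L: prob_space ?L by (rule prob_space_param_law[OF N B0(1) D1(1)])
  show "(\<integral>\<^sup>+ \<theta>. Lip d (shallow_net d N \<theta>) \<partial>?L) \<le> ennreal (3000 * sqrt (real d))"
    by (rule nn_integral_Lip_le[OF d N B0 D1])
  note [measurable] = Lip_measurable[OF B0(2) D1(2), of d]
  define E where "E = {\<theta> \<in> space ?L. ennreal (1000 * 1 * sqrt d) < Lip d (shallow_net d N \<theta>)}"
  have E: "E \<in> sets ?L" unfolding E_def by measurable
  have "emeasure ?L E \<le> ennreal (2 * exp (- (1 * real (min d N))))"
    unfolding E_def by (rule Lip_tail[OF d N _ B0 D1]) simp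
  then have pE: "measure ?L E \<le> 2 * exp (- real (min d N))"
    by (simp add: L.emeasure_eq_measure)
  show "\<exists>A \<in> sets ?L. A \<subseteq> {\<theta> \<in> space ?L. Lip d (shallow_net d N \<theta>) \<le> ennreal (3000 * sqrt (real d))} \<and>
      measure ?L A \<ge> (1 - 2 * exp (- real (min d N))) * max 0 (1 - 2 * exp (- 1 * real (max d N)))"
  proof (intro bexI[of _ "space ?L - E"] conjI)
    show "space ?L - E \<in> sets ?L" using E by auto
    have "ennreal (1000 * 1 * sqrt d) \<le> ennreal (3000 * sqrt (real d))" by (intro ennreal_leI) simp
    then show "space ?L - E \<subseteq> {\<theta> \<in> space ?L. Lip d (shallow_net d N \<theta>) \<le> ennreal (3000 * sqrt (real d))}"
      unfolding E_def by (auto simp: not_less intro: order_trans)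
    \<comment> \<open>The first factor is nonnegative since \<open>exp 1 >= 2\<close>, so
      multiplying it by the second factor, which is at most 1, cannot increase it.\<close>
    have "2 * exp (- real (min d N)) \<le> 1"
    proof -
      have "(2::real) \<le> exp 1" using exp_ge_add_one_self[of 1] by simp
      also have "\<dots> \<le> exp (real (min d N))" using d N by simp
      finally show ?thesis by (simp add: exp_minus field_simps)
    qed
    then have "(1 - 2 * exp (- real (min d N))) * max 0 (1 - 2 * exp (- 1 * real (max d N)))
        \<le> (1 - 2 * exp (- real (min d N))) * 1"
      by (intro mult_left_mono) auto
    also have "\<dots> \<le> measure ?L (space ?L - E)" using pE E by (simp add: L.prob_compl)
    finally show "(1 - 2 * exp (- real (min d N))) * max 0 (1 - 2 * exp (- 1 * real (max d N)))
        \<le> measure ?L (space ?L - E)" .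
  qed
qed auto

end
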